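(* There is an algorithm which, given a finite forest algebra $(H,V)$ (by its finite operation tables), decides whether $(H,V)$ is 2-distributive.
   Context: A forest algebra is a pair $(H,V)$ where $H$ is a monoid written additively (neutral element $0_H$), $V$ is a monoid written multiplicatively, and $V$ acts faithfully on $H$. For every $h$ there is $I_h\in V$ with $I_h h'=h+h'$, and every $h\in H$ equals $v\cdot 0_H$ for some $v\in V$. All forest algebras are assumed horizontally commutative and idempotent ($h_1+h_2=h_2+h_1$, $h+h=h$). Morphisms preserve all of this structure. The free forest algebra $\Sigma^\Delta=(H_\Sigma,V_\Sigma)$ over a finite alphabet $\Sigma$ consists of forests and contexts. Trees are $\alpha[C]$ with $\alpha\in\Sigma$ and $C$ a finite set of trees; forests are finite sets of trees under union. Contexts are forests with one leaf replaced by a hole, composed and acting by substitution. For a forest $f$, $\pi(f)\subseteq\Sigma^*$ denotes the prefix-closed set of (not necessarily maximal) root-starting label paths of $f$. $(H,V)$ is 2-distributive if for every finite alphabet $\Sigma$, every morphism $\phi:\Sigma^\Delta\to(H,V)$, every context $v\in V_\Sigma$, and all forests $f_1,f_2$ with $\pi(f_1)=\pi(f_2)$, we have $\phi(v(f_1+f_2))=\phi(vf_1+vf_2)$. *)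

theory Defs
  imports Main "HOL-Library.FSet" "HOL-Library.Nat_Bijection"
begin

definition forest_algebra ::
  "'h set \<Rightarrow> ('h \<Rightarrow> 'h \<Rightarrow> 'h) \<Rightarrow> 'h \<Rightarrow> 'v set \<Rightarrow> ('v \<Rightarrow> 'v \<Rightarrow> 'v) \<Rightarrow> 'v \<Rightarrow> ('v \<Rightarrow> 'h \<Rightarrow> 'h) \<Rightarrow> bool"
where
  "forest_algebra H pl z V mu e ac \<longleftrightarrow>
     z \<in> H \<and> e \<in> V \<and>
     (\<forall>a\<in>H. \<forall>b\<in>H. pl a b \<in> H) \<and>
     (\<forall>v\<in>V. \<forall>w\<in>V. mu v w \<in> V) \<and>
     (\<forall>v\<in>V. \<forall>h\<in>H. ac v h \<in> H) \<and>
     (\<forall>a\<in>H. \<forall>b\<in>H. \<forall>c\<in>H. pl (pl a b) c = pl a (pl b c)) \<and>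
     (\<forall>a\<in>H. pl z a = a \<and> pl a z = a) \<and>
     (\<forall>a\<in>H. \<forall>b\<in>H. pl a b = pl b a) \<and>
     (\<forall>a\<in>H. pl a a = a) \<and>
     (\<forall>u\<in>V. \<forall>v\<in>V. \<forall>w\<in>V. mu (mu u v) w = mu u (mu v w)) \<and>
     (\<forall>v\<in>V. mu e v = v \<and> mu v e = v) \<and>
     (\<forall>v\<in>V. \<forall>w\<in>V. \<forall>h\<in>H. ac (mu v w) h = ac v (ac w h)) \<and>
     (\<forall>h\<in>H. ac e h = h) \<and>
     (\<forall>v\<in>V. \<forall>w\<in>V. (\<forall>h\<in>H. ac v h = ac w h) \<longrightarrow> v = w) \<and>
     (\<forall>h\<in>H. \<exists>I\<in>V. \<forall>h'\<in>H. ac I h' = pl h h') \<and>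
     (\<forall>h\<in>H. \<exists>v\<in>V. h = ac v z)"

datatype 'a tree = Node 'a "'a tree fset"

type_synonym 'a forest = "'a tree fset"

text \<open>Contexts: Hole f is the context f + hole; CNode f a c is the context f + a[c].\<close>
datatype 'a ctx = Hole "'a forest" | CNode "'a forest" 'a "'a ctx"

primrec tlabels :: "'a tree \<Rightarrow> 'a set" where
  "tlabels (Node a c) = insert a (\<Union> (fset (fimage tlabels c)))"

definition flabels :: "'a forest \<Rightarrow> 'a set" where
  "flabels f = \<Union> (tlabels ` fset f)"

primrec clabels :: "'a ctx \<Rightarrow> 'a set" where
  "clabels (Hole f) = flabels f"
| "clabels (CNode f a c) = flabels f \<union> insert a (clabels c)"

primrec capp :: "'a ctx \<Rightarrow> 'a forest \<Rightarrow> 'a forest" where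
  "capp (Hole f) g = f |\<union>| g"
| "capp (CNode f a c) g = f |\<union>| {|Node a (capp c g)|}"

primrec cadd :: "'a forest \<Rightarrow> 'a ctx \<Rightarrow> 'a ctx" where
  "cadd f (Hole g) = Hole (f |\<union>| g)"
| "cadd f (CNode g a c) = CNode (f |\<union>| g) a c"

primrec ccomp :: "'a ctx \<Rightarrow> 'a ctx \<Rightarrow> 'a ctx" where
  "ccomp (Hole f) w = cadd f w"
| "ccomp (CNode f a c) w = CNode f a (ccomp c w)"

definition cid :: "'a ctx" where "cid = Hole {||}"

text \<open>pi(f): the (prefix-closed) set of root-starting label paths of f
  (nonempty paths; adding the empty path would not change equality of pi-sets).\<close>
primrec tpaths :: "'a tree \<Rightarrow> 'a list set" where
  "tpaths (Node a c) = insert [a] ((\<lambda>p. a # p) ` \<Union> (fset (fimage tpaths c)))"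

definition fpaths :: "'a forest \<Rightarrow> 'a list set" where
  "fpaths f = \<Union> (tpaths ` fset f)"

text \<open>Alphabets are finite sets of natural numbers (every finite alphabet is, up to renaming,
  of this form). phiH is defined on forests over Sigma, phiV on contexts over Sigma.\<close>

definition fa_morphism ::
  "nat set \<Rightarrow> 'h set \<Rightarrow> ('h \<Rightarrow> 'h \<Rightarrow> 'h) \<Rightarrow> 'h \<Rightarrow> 'v set \<Rightarrow> ('v \<Rightarrow> 'v \<Rightarrow> 'v) \<Rightarrow> 'v \<Rightarrow> ('v \<Rightarrow> 'h \<Rightarrow> 'h)
   \<Rightarrow> (nat forest \<Rightarrow> 'h) \<Rightarrow> (nat ctx \<Rightarrow> 'v) \<Rightarrow> bool"
where
  "fa_morphism \<Sigma> H pl z V mu e ac \<phi>H \<phi>V \<longleftrightarrow>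
     (\<forall>f. flabels f \<subseteq> \<Sigma> \<longrightarrow> \<phi>H f \<in> H) \<and>
     (\<forall>v. clabels v \<subseteq> \<Sigma> \<longrightarrow> \<phi>V v \<in> V) \<and>
     \<phi>H {||} = z \<and>
     (\<forall>f g. flabels f \<subseteq> \<Sigma> \<longrightarrow> flabels g \<subseteq> \<Sigma> \<longrightarrow> \<phi>H (f |\<union>| g) = pl (\<phi>H f) (\<phi>H g)) \<and>
     \<phi>V cid = e \<and>
     (\<forall>v w. clabels v \<subseteq> \<Sigma> \<longrightarrow> clabels w \<subseteq> \<Sigma> \<longrightarrow> \<phi>V (ccomp v w) = mu (\<phi>V v) (\<phi>V w)) \<and>
     (\<forall>v f. clabels v \<subseteq> \<Sigma> \<longrightarrow> flabels f \<subseteq> \<Sigma> \<longrightarrow> \<phi>H (capp v f) = ac (\<phi>V v) (\<phi>H f)) \<and>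
     (\<forall>f. flabels f \<subseteq> \<Sigma> \<longrightarrow> (\<forall>h\<in>H. ac (\<phi>V (Hole f)) h = pl (\<phi>H f) h))"

definition two_distributive ::
  "'h set \<Rightarrow> ('h \<Rightarrow> 'h \<Rightarrow> 'h) \<Rightarrow> 'h \<Rightarrow> 'v set \<Rightarrow> ('v \<Rightarrow> 'v \<Rightarrow> 'v) \<Rightarrow> 'v \<Rightarrow> ('v \<Rightarrow> 'h \<Rightarrow> 'h) \<Rightarrow> bool"
where
  "two_distributive H pl z V mu e ac \<longleftrightarrow>
     (\<forall>\<Sigma>::nat set. finite \<Sigma> \<longrightarrow>
       (\<forall>\<phi>H \<phi>V. fa_morphism \<Sigma> H pl z V mu e ac \<phi>H \<phi>V \<longrightarrow>
         (\<forall>v f1 f2. clabels v \<subseteq> \<Sigma> \<longrightarrow> flabels f1 \<subseteq> \<Sigma> \<longrightarrow> flabels f2 \<subseteq> \<Sigma> \<longrightarrow>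
            fpaths f1 = fpaths f2 \<longrightarrow>
            \<phi>H (capp v (f1 |\<union>| f2)) = pl (\<phi>H (capp v f1)) (\<phi>H (capp v f2)))))"

text \<open>H = {0..<n}, V = {0..<m}; tables are row-major lists:
  P (length n*n) for +, M (length m*m) for the product of V, A (length m*n) for the action.\<close>

definition tbl :: "nat \<Rightarrow> nat list \<Rightarrow> nat \<Rightarrow> nat \<Rightarrow> nat" where
  "tbl k T a b = T ! (a * k + b)"

definition table_fa :: "nat \<Rightarrow> nat \<Rightarrow> nat list \<Rightarrow> nat list \<Rightarrow> nat list \<Rightarrow> bool" where
  "table_fa n m P M A \<longleftrightarrow>
     length P = n * n \<and> length M = m * m \<and> length A = m * n \<and>
     (\<exists>z e. forest_algebra {..<n} (tbl n P) z {..<m} (tbl m M) e (tbl n A))"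

definition table_2dist :: "nat \<Rightarrow> nat \<Rightarrow> nat list \<Rightarrow> nat list \<Rightarrow> nat list \<Rightarrow> bool" where
  "table_2dist n m P M A \<longleftrightarrow>
     (\<exists>z e. forest_algebra {..<n} (tbl n P) z {..<m} (tbl m M) e (tbl n A) \<and>
            two_distributive {..<n} (tbl n P) z {..<m} (tbl m M) e (tbl n A))"

definition table_code :: "nat \<Rightarrow> nat \<Rightarrow> nat list \<Rightarrow> nat list \<Rightarrow> nat list \<Rightarrow> nat" where
  "table_code n m P M A = list_encode [n, m, list_encode P, list_encode M, list_encode A]"

datatype recf =
    Zero
  | Succ
  | Proj nat
  | Comp recf "recf list"
  | Prim recf recf
  | Mini recf

inductive recf_eval :: "recf \<Rightarrow> nat list \<Rightarrow> nat \<Rightarrow> bool" where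
  zero: "recf_eval Zero xs 0"
| succ: "recf_eval Succ (x # xs) (Suc x)"
| proj: "i < length xs \<Longrightarrow> recf_eval (Proj i) xs (xs ! i)"
| comp: "list_all2 (\<lambda>g y. recf_eval g xs y) gs ys \<Longrightarrow> recf_eval f ys y \<Longrightarrow> recf_eval (Comp f gs) xs y"
| prim0: "recf_eval f xs y \<Longrightarrow> recf_eval (Prim f g) (0 # xs) y"
| primS: "recf_eval (Prim f g) (k # xs) r \<Longrightarrow> recf_eval g (r # k # xs) y \<Longrightarrow> recf_eval (Prim f g) (Suc k # xs) y"
| mini: "recf_eval f (y # xs) 0 \<Longrightarrow> (\<forall>k<y. \<exists>r. recf_eval f (k # xs) r \<and> r \<noteq> 0) \<Longrightarrow> recf_eval (Mini f) xs y"

end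

theory Submission
  imports Defs
begin

text \<open>
  By freeness only the alphabet \<open>V\<close> with its tautological morphism matters, so one has to
  determine which pairs of values are taken by forests with equal path sets. Assign to a path
  set \<open>L\<close> its type: the set of all \<open>{value f | f \<in> F}\<close>, where \<open>F\<close> is a finite nonempty family of
  forests whose path sets have union \<open>L\<close>. Allowing whole families, whose members need not
  have path set \<open>L\<close> themselves, makes types compositional: the type of \<open>L\<close> is determined by
  its set of first letters \<open>a\<close> and the types of the quotients of \<open>L\<close> by these \<open>a\<close>. Since \<open>H\<close>
  is finite, there are finitely many types, and \<open>(H, V)\<close> is 2-distributive iff there is a set
  \<open>C\<close> of types that is closed (up to inclusion) under this composition and such that every
  \<open>v\<close> distributes over \<open>g + h\<close> whenever \<open>{g}\<close> and \<open>{h}\<close> belong to a common type in \<open>C\<close>. Coding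
  sets by binary expansions turns this criterion into an arithmetic formula with bounded
  quantifiers.
\<close>

section \<open>Partial recursive functions and decidable predicates\<close>

definition computable :: "nat \<Rightarrow> (nat list \<Rightarrow> nat) \<Rightarrow> bool" where
  "computable k f \<longleftrightarrow> (\<exists>p. \<forall>xs. length xs = k \<longrightarrow> recf_eval p xs (f xs))"

definition decidable :: "nat \<Rightarrow> (nat list \<Rightarrow> bool) \<Rightarrow> bool" where
  "decidable k P \<longleftrightarrow> computable k (\<lambda>xs. of_bool (P xs))"

text \<open>Variables bound by nested quantifiers are addressed in de Bruijn style as
  \<open>hd (tl (\<dots> (tl xs)))\<close>; the predicate below lets resolution count the tails.\<close>

definition tail_at :: "nat \<Rightarrow> (nat list \<Rightarrow> nat list) \<Rightarrow> bool" where
  "tail_at j g \<longleftrightarrow> g = drop j"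

lemma tail_at_0: "tail_at 0 (\<lambda>xs. xs)"
  by (auto simp: tail_at_def)

lemma tail_at_Suc: "tail_at j g \<Longrightarrow> tail_at (Suc j) (\<lambda>xs. tl (g xs))"
  by (auto simp: tail_at_def tl_drop drop_Suc fun_eq_iff)

lemma computable_var:
  assumes "tail_at j g" "j < k" shows "computable k (\<lambda>xs. hd (g xs))"
  unfolding computable_def
proof (intro exI[of _ "Proj j"] allI impI)
  fix xs :: "nat list" assume "length xs = k"
  with assms show "recf_eval (Proj j) xs (hd (g xs))"
    by (auto simp: tail_at_def hd_drop_conv_nth intro: recf_eval.proj)
qed

lemma computable_comp:
  assumes f: "computable (length gs) f" and gs: "\<And>g. g \<in> set gs \<Longrightarrow> computable k g"
  shows "computable k (\<lambda>xs. f (map (\<lambda>g. g xs) gs))"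
proof -
  obtain p where p: "\<And>ys. length ys = length gs \<Longrightarrow> recf_eval p ys (f ys)"
    using f by (auto simp: computable_def)
  obtain q where q: "\<And>g xs. g \<in> set gs \<Longrightarrow> length xs = k \<Longrightarrow> recf_eval (q g) xs (g xs)"
    using gs unfolding computable_def by metis
  have "recf_eval (Comp p (map q gs)) xs (f (map (\<lambda>g. g xs) gs))" if "length xs = k" for xs
    using that by (intro recf_eval.comp[where ys = "map (\<lambda>g. g xs) gs"] p)
      (auto simp: list_all2_map1 list_all2_map2 intro!: list.rel_refl_strong q)
  thus ?thesis unfolding computable_def by blast
qed

text \<open>A closure property is proved once for an operation on variables; this form then
  substitutes arbitrary computable terms for them.\<close>

lemma computable_comp1:
  assumes "computable 1 (\<lambda>xs. F (hd xs))" "computable k a"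
  shows "computable k (\<lambda>xs. F (a xs))"
  using computable_comp[of "[a]" "\<lambda>xs. F (hd xs)" k] assms by simp

lemma computable_comp2:
  assumes "computable 2 (\<lambda>xs. F (hd xs) (hd (tl xs)))" "computable k a" "computable k b"
  shows "computable k (\<lambda>xs. F (a xs) (b xs))"
  using computable_comp[of "[a, b]" "\<lambda>xs. F (hd xs) (hd (tl xs))" k] assms
  by (auto simp: numeral_2_eq_2)

lemma decidable_comp2:
  assumes "decidable 2 (\<lambda>xs. F (hd xs) (hd (tl xs)))" "computable k a" "computable k b"
  shows "decidable k (\<lambda>xs. F (a xs) (b xs))"
  using computable_comp2[of "\<lambda>x y. of_bool (F x y)"] assms by (simp add: decidable_def)

lemma decidable_comp4:
  assumes "decidable 4 (\<lambda>xs. F (hd xs) (hd (tl xs)) (hd (tl (tl xs))) (hd (tl (tl (tl xs)))))"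
    "computable k a" "computable k b" "computable k c" "computable k d"
  shows "decidable k (\<lambda>xs. F (a xs) (b xs) (c xs) (d xs))"
  using computable_comp[of "[a, b, c, d]"
      "\<lambda>xs. of_bool (F (hd xs) (hd (tl xs)) (hd (tl (tl xs))) (hd (tl (tl (tl xs)))))" k] assms
  by (auto simp: decidable_def eval_nat_numeral)

lemma computable_Suc:
  assumes "computable k a" shows "computable k (\<lambda>xs. Suc (a xs))"
proof (rule computable_comp1[OF _ assms])
  have "recf_eval Succ xs (Suc (hd xs))" if "length xs = 1" for xs
    using that by (cases xs) (auto intro: recf_eval.succ)
  thus "computable 1 (\<lambda>xs. Suc (hd xs))" unfolding computable_def by blast
qed

lemma computable_const: "computable k (\<lambda>_. c)"
proof (induction c)
  case 0
  show ?case unfolding computable_def by (blast intro: recf_eval.zero)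
next
  case (Suc c)
  thus ?case by (rule computable_Suc)
qed

text \<open>\<open>Prim\<close> hands its step function the previous value, then the counter, then
  the parameters, which dictates how \<open>g\<close> reads its arguments.\<close>

lemma computable_rec:
  assumes f: "computable k f" and b: "computable k b"
    and g: "computable (Suc (Suc k)) (\<lambda>xs. g (hd xs) (hd (tl xs)) (tl (tl xs)))"
  shows "computable k (\<lambda>xs. rec_nat (f xs) (\<lambda>i r. g r i xs) (b xs))"
proof -
  obtain p where p: "\<And>xs. length xs = k \<Longrightarrow> recf_eval p xs (f xs)"
    using f by (auto simp: computable_def)
  obtain q where q: "\<And>xs. length xs = Suc (Suc k) \<Longrightarrow>
      recf_eval q xs (g (hd xs) (hd (tl xs)) (tl (tl xs)))"
    using g by (auto simp: computable_def)
  have pq: "recf_eval (Prim p q) (i # xs) (rec_nat (f xs) (\<lambda>i r. g r i xs) i)"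
    if "length xs = k" for xs i
  proof (induction i)
    case 0
    show ?case using p that by (auto intro: recf_eval.prim0)
  next
    case (Suc i)
    show ?case
      using recf_eval.primS[OF Suc] q[of "rec_nat (f xs) (\<lambda>i r. g r i xs) i # i # xs"] that
      by simp
  qed
  let ?R = "\<lambda>ys. rec_nat (f (tl ys)) (\<lambda>i r. g r i (tl ys)) (hd ys)"
  have "recf_eval (Prim p q) ys (?R ys)" if "length ys = Suc k" for ys
    using that pq[of "tl ys" "hd ys"] by (cases ys) auto
  hence R: "computable (Suc k) ?R" unfolding computable_def by blast
  \<comment> \<open>\<open>Prim\<close> takes the counter first, so \<open>b\<close> is composed in,
    followed by the \<open>k\<close> projections that restore \<open>xs\<close>.\<close>
  let ?gs = "b # map (\<lambda>j xs. xs ! j) [0..<k]"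
  have "computable k (\<lambda>xs. ?R (map (\<lambda>g. g xs) ?gs))"
  proof (rule computable_comp)
    show "computable (length ?gs) ?R" using R by simp
    fix g assume "g \<in> set ?gs"
    then consider "g = b" | j where "j < k" "g = (\<lambda>xs. xs ! j)" by auto
    thus "computable k g"
    proof cases
      case 2
      thus ?thesis unfolding computable_def by (auto intro!: exI[of _ "Proj j"] recf_eval.proj)
    qed (use b in simp)
  qed
  moreover have "map (\<lambda>g. g xs) (map (\<lambda>j xs. xs ! j) [0..<k]) = xs"
    if "length xs = k" for xs :: "nat list"
    using that by (auto simp: o_def intro: nth_equalityI)
  ultimately show ?thesis unfolding computable_def by auto
qed

lemma computable_cong:
  assumes "computable k f" "\<And>xs. length xs = k \<Longrightarrow> f xs = g xs"
  shows "computable k g"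
  using assms unfolding computable_def by metis

section \<open>Arithmetic, Boolean connectives, bounded quantifiers and minimisation\<close>

lemma computable_add:
  assumes "computable k a" "computable k b"
  shows "computable k (\<lambda>xs. a xs + b xs)"
proof -
  have "computable 2 (\<lambda>xs. rec_nat (hd xs) (\<lambda>i r. Suc r) (hd (tl xs)))"
    by (rule computable_rec computable_var computable_Suc tail_at_0 tail_at_Suc | simp)+
  moreover have "rec_nat x (\<lambda>i r. Suc r) y = x + y" for x y :: nat
    by (induction y) auto
  ultimately show ?thesis using computable_comp2[of "(+)"] assms by simp
qed

lemma computable_mult:
  assumes "computable k a" "computable k b"
  shows "computable k (\<lambda>xs. a xs * b xs)"
proof -
  have "computable 2 (\<lambda>xs. rec_nat 0 (\<lambda>i r. hd xs + r) (hd (tl xs)))"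
    by (rule computable_rec computable_var computable_add computable_const tail_at_0 tail_at_Suc
        | simp)+
  moreover have "rec_nat 0 (\<lambda>i r. x + r) y = x * y" for x y :: nat
    by (induction y) auto
  ultimately show ?thesis using computable_comp2[of "(*)"] assms by simp
qed

lemma computable_power:
  assumes "computable k a" "computable k b"
  shows "computable k (\<lambda>xs. a xs ^ b xs)"
proof -
  have "computable 2 (\<lambda>xs. rec_nat 1 (\<lambda>i r. hd xs * r) (hd (tl xs)))"
    by (rule computable_rec computable_var computable_mult computable_const tail_at_0 tail_at_Suc
        | simp)+
  moreover have "rec_nat 1 (\<lambda>i r. x * r) y = x ^ y" for x y :: nat
    by (induction y) auto
  ultimately show ?thesis using computable_comp2[of "(^)"] assms by simp
qed

lemma computable_pred:
  assumes "computable k a"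
  shows "computable k (\<lambda>xs. a xs - 1)"
proof -
  have "computable 1 (\<lambda>xs. rec_nat 0 (\<lambda>i r. i) (hd xs))"
    by (rule computable_rec computable_var computable_const tail_at_0 tail_at_Suc | simp)+
  moreover have "rec_nat 0 (\<lambda>i r. i) y = y - 1" for y :: nat
    by (cases y) auto
  ultimately show ?thesis using computable_comp1[of "\<lambda>y. y - 1"] assms by simp
qed

lemma computable_diff:
  assumes "computable k a" "computable k b"
  shows "computable k (\<lambda>xs. a xs - b xs)"
proof -
  have "computable 2 (\<lambda>xs. rec_nat (hd xs) (\<lambda>i r. r - 1) (hd (tl xs)))"
    by (rule computable_rec computable_var computable_pred tail_at_0 tail_at_Suc | simp)+
  moreover have "rec_nat x (\<lambda>i r. r - 1) y = x - y" for x y :: nat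
    by (induction y) auto
  ultimately show ?thesis using computable_comp2[of "(-)"] assms by simp
qed

lemma decidable_not: "decidable k P \<Longrightarrow> decidable k (\<lambda>xs. \<not> P xs)"
  unfolding decidable_def
  by (rule computable_cong[OF computable_diff[OF computable_const[of _ 1]]]) auto

lemma decidable_conj:
  "decidable k P \<Longrightarrow> decidable k Q \<Longrightarrow> decidable k (\<lambda>xs. P xs \<and> Q xs)"
  unfolding decidable_def by (drule (1) computable_mult) (simp add: of_bool_conj)

lemma decidable_imp:
  "decidable k P \<Longrightarrow> decidable k Q \<Longrightarrow> decidable k (\<lambda>xs. P xs \<longrightarrow> Q xs)"
  using decidable_not[OF decidable_conj[OF _ decidable_not]] by simp

lemma decidable_iff:
  "decidable k P \<Longrightarrow> decidable k Q \<Longrightarrow> decidable k (\<lambda>xs. P xs \<longleftrightarrow> Q xs)"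
  using decidable_conj[OF decidable_imp[of k P Q] decidable_imp[of k Q P]]
  by (simp add: iff_conv_conj_imp)

text \<open>With truncated subtraction, \<open>(a - b) + (b - a)\<close> vanishes exactly for equal
  arguments; subtracting it from 1 gives the characteristic function.\<close>

lemma decidable_eq:
  assumes "computable k a" "computable k b"
  shows "decidable k (\<lambda>xs. a xs = b xs)"
  unfolding decidable_def
  by (rule computable_cong[OF computable_diff[OF computable_const[of _ 1]
      computable_add[OF computable_diff[OF assms] computable_diff[OF assms(2,1)]]]]) auto

text \<open>Weakening by a dummy first argument, for recursion steps whose accumulator the predicate
  does not mention.\<close>

lemma computable_tl:
  assumes "computable k f" shows "computable (Suc k) (\<lambda>xs. f (tl xs))"
proof -
  let ?gs = "map (\<lambda>j xs. xs ! Suc j) [0..<k] :: (nat list \<Rightarrow> nat) list"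
  have "computable (Suc k) (\<lambda>xs. f (map (\<lambda>g. g xs) ?gs))"
  proof (rule computable_comp)
    show "computable (length ?gs) f" using assms by simp
    fix g assume "g \<in> set ?gs"
    then obtain j where "j < k" "g = (\<lambda>xs. xs ! Suc j)" by auto
    thus "computable (Suc k) g"
      unfolding computable_def by (auto intro!: exI[of _ "Proj (Suc j)"] recf_eval.proj)
  qed
  moreover have "map (\<lambda>g. g xs) ?gs = tl xs" if "length xs = Suc k" for xs :: "nat list"
    using that by (auto simp: o_def nth_tl intro!: nth_equalityI)
  ultimately show ?thesis by (elim computable_cong) simp
qed

lemma decidable_Ex_less:
  assumes "decidable (Suc k) (\<lambda>xs. P (hd xs) (tl xs))" "computable k b"
  shows "decidable k (\<lambda>xs. \<exists>i<b xs. P i xs)"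
proof -
  have P: "computable (Suc (Suc k)) (\<lambda>xs. of_bool (P (hd (tl xs)) (tl (tl xs))))"
    using computable_tl assms(1) by (auto simp: decidable_def)
  \<comment> \<open>The accumulator \<open>r\<close> is the truth value of the search so far;
    \<open>1 - (1 - r) * (1 - s)\<close> is disjunction on the values 0 and 1.\<close>
  have "computable k (\<lambda>xs. rec_nat 0 (\<lambda>i r. 1 - (1 - r) * (1 - of_bool (P i xs))) (b xs))"
    by (rule computable_rec assms computable_const computable_diff computable_mult P
        computable_var tail_at_0 | simp)+
  moreover have "rec_nat 0 (\<lambda>i r. 1 - (1 - r) * (1 - of_bool (P i xs))) c = (of_bool (\<exists>i<c. P i xs) :: nat)"
    for xs c
    by (induction c) (auto simp: less_Suc_eq)
  ultimately show ?thesis by (simp add: decidable_def)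
qed

lemma decidable_All_less:
  assumes "decidable (Suc k) (\<lambda>xs. P (hd xs) (tl xs))" "computable k b"
  shows "decidable k (\<lambda>xs. \<forall>i<b xs. P i xs)"
  using decidable_not[OF decidable_Ex_less[of k "\<lambda>i xs. \<not> P i xs", OF decidable_not]] assms
  by simp

text \<open>\<open>Mini\<close> looks for a zero, so it is applied to a program for the negated
  predicate. The assumption \<open>ex\<close> makes the search terminate.\<close>

lemma computable_Least:
  assumes P: "decidable (Suc k) (\<lambda>xs. P (hd xs) (tl xs))" and ex: "\<And>xs. \<exists>i. P i xs"
  shows "computable k (\<lambda>xs. LEAST i. P i xs)"
proof -
  obtain p where p: "\<And>xs. length xs = Suc k \<Longrightarrow> recf_eval p xs (of_bool (\<not> P (hd xs) (tl xs)))"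
    using decidable_not[OF P] by (auto simp: decidable_def computable_def)
  have "recf_eval (Mini p) xs (LEAST i. P i xs)" if "length xs = k" for xs
  proof (rule recf_eval.mini)
    show "recf_eval p ((LEAST i. P i xs) # xs) 0"
      using p[of "(LEAST i. P i xs) # xs"] that LeastI_ex[OF ex] by simp
    show "\<forall>j<LEAST i. P i xs. \<exists>r. recf_eval p (j # xs) r \<and> r \<noteq> 0"
    proof (intro allI impI)
      fix j assume "j < (LEAST i. P i xs)"
      hence "\<not> P j xs" by (rule not_less_Least)
      thus "\<exists>r. recf_eval p (j # xs) r \<and> r \<noteq> 0" using p[of "j # xs"] that by auto
    qed
  qed
  thus ?thesis unfolding computable_def by blast
qed

text \<open>A syntax-directed calculus: repeated resolution reduces an arithmetic formula with
  bounded quantifiers to its variables and constants.\<close>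

lemmas computability_rules =
  tail_at_0 tail_at_Suc computable_var computable_const computable_Suc computable_add
  computable_mult computable_power computable_diff
  decidable_not decidable_conj decidable_imp decidable_iff decidable_eq
  decidable_Ex_less decidable_All_less

section \<open>Decoding binary expansions, pairs and lists\<close>

lemma mem_set_decode_iff_bounded:
  "i \<in> set_decode s \<longleftrightarrow> (\<exists>q<Suc s. \<exists>r<2 ^ i. s = Suc (2 * q) * 2 ^ i + r)"
proof
  assume "i \<in> set_decode s"
  \<comment> \<open>Membership means that the quotient by \<open>2 ^ i\<close> is odd. Naming
    quotient and remainder replaces division by sums, products and powers under bounded
    quantifiers.\<close>
  then obtain q where q: "s div 2 ^ i = Suc (2 * q)" by (auto simp: set_decode_def elim!: oddE)
  hence "s = Suc (2 * q) * 2 ^ i + s mod 2 ^ i" by (metis div_mult_mod_eq)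
  moreover have "q < Suc s"
    using q div_le_dividend[of s "2 ^ i"] by linarith
  ultimately show "\<exists>q<Suc s. \<exists>r<2 ^ i. s = Suc (2 * q) * 2 ^ i + r"
    by (meson mod_less_divisor zero_less_numeral zero_less_power)
next
  assume "\<exists>q<Suc s. \<exists>r<2 ^ i. s = Suc (2 * q) * 2 ^ i + r"
  then obtain q r where "r < 2 ^ i" "s = r + Suc (2 * q) * 2 ^ i" by (auto simp: add.commute)
  hence "s div 2 ^ i = Suc (2 * q)" by (simp del: mult_Suc)
  thus "i \<in> set_decode s" by (simp add: set_decode_def)
qed

lemma decidable_mem_set_decode:
  assumes "computable k a" "computable k b"
  shows "decidable k (\<lambda>xs. a xs \<in> set_decode (b xs))"
proof (rule decidable_comp2[OF _ assms])
  show "decidable 2 (\<lambda>xs. hd xs \<in> set_decode (hd (tl xs)))"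
    unfolding mem_set_decode_iff_bounded by (rule computability_rules | simp)+
qed

text \<open>Doubling clears the division by 2 in the triangular number that occurs in the Cantor
  pairing function.\<close>

lemma prod_encode_eq_iff:
  "prod_encode (x, y) = c \<longleftrightarrow> 2 * c = (x + y) * Suc (x + y) + 2 * x"
proof -
  have "2 * prod_encode (x, y) = (x + y) * Suc (x + y) + 2 * x"
    by (simp add: prod_encode_def triangle_def)
  thus ?thesis by linarith
qed

text \<open>Neither component of a pair exceeds its code, so the other component can be searched for
  below \<open>Suc c\<close>.\<close>

lemma fst_prod_decode_iff:
  "(\<exists>y<Suc c. 2 * c = (x + y) * Suc (x + y) + 2 * x) \<longleftrightarrow> x = fst (prod_decode c)"
  unfolding prod_encode_eq_iff[symmetric] less_Suc_eq_le
  by (metis fst_conv le_prod_encode_2 prod.collapse prod_decode_inverse prod_encode_inverse)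

lemma snd_prod_decode_iff:
  "(\<exists>x<Suc c. 2 * c = (x + y) * Suc (x + y) + 2 * x) \<longleftrightarrow> y = snd (prod_decode c)"
  unfolding prod_encode_eq_iff[symmetric] less_Suc_eq_le
  by (metis snd_conv le_prod_encode_1 prod.collapse prod_decode_inverse prod_encode_inverse)

text \<open>A function with decidable graph is computable: minimisation finds the only value in the
  graph.\<close>

lemma computable_the:
  assumes "decidable (Suc k) (\<lambda>xs. hd xs = f (tl xs))"
  shows "computable k f"
  using computable_Least[of k "\<lambda>y xs. y = f xs"] assms by (simp add: Least_equality)

lemma computable_fst_prod_decode:
  assumes "computable k a" shows "computable k (\<lambda>xs. fst (prod_decode (a xs)))"
proof (rule computable_comp1[OF computable_the assms])
  show "decidable (Suc 1) (\<lambda>xs. hd xs = fst (prod_decode (hd (tl xs))))"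
    unfolding fst_prod_decode_iff[symmetric] by (rule computability_rules | simp)+
qed

lemma computable_snd_prod_decode:
  assumes "computable k a" shows "computable k (\<lambda>xs. snd (prod_decode (a xs)))"
proof (rule computable_comp1[OF computable_the assms])
  show "decidable (Suc 1) (\<lambda>xs. hd xs = snd (prod_decode (hd (tl xs))))"
    unfolding snd_prod_decode_iff[symmetric] by (rule computability_rules | simp)+
qed

text \<open>The \<open>i\<close>-th entry of the list encoded by \<open>c\<close>; beyond the end of the list it
  has a junk value.\<close>

definition code_nth :: "nat \<Rightarrow> nat \<Rightarrow> nat" where
  "code_nth c i = fst (prod_decode (rec_nat c (\<lambda>_ r. snd (prod_decode (r - 1))) i - 1))"

text \<open>The code of a nonempty list is the successor of the pair of its head and the code of its
  tail, so each iteration drops one entry.\<close>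

lemma code_nth_list_encode: "i < length xs \<Longrightarrow> code_nth (list_encode xs) i = xs ! i"
proof -
  \<comment> \<open>Moves the last iteration to the front, where it matches removing the head of the
    list.\<close>
  have shift: "rec_nat c (\<lambda>_ r. f r) (Suc i) = rec_nat (f c) (\<lambda>_ r. f r) i" for c i and f :: "nat \<Rightarrow> nat"
    by (induction i) auto
  show "i < length xs \<Longrightarrow> code_nth (list_encode xs) i = xs ! i"
  proof (induction xs arbitrary: i)
    case (Cons x xs)
    show ?case
    proof (cases i)
      case (Suc j)
      thus ?thesis using Cons by (simp add: code_nth_def shift del: nat.rec)
    qed (simp add: code_nth_def)
  qed simp
qed

lemma computable_code_nth:
  assumes "computable k a" "computable k b"
  shows "computable k (\<lambda>xs. code_nth (a xs) (b xs))"
proof (rule computable_comp2[OF _ assms])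
  show "computable 2 (\<lambda>xs. code_nth (hd xs) (hd (tl xs)))"
    unfolding code_nth_def
    by (rule computability_rules computable_rec computable_fst_prod_decode
        computable_snd_prod_decode | simp)+
qed

section \<open>Types of path sets\<close>

lemma tlabels_Node: "tlabels (Node a c) = insert a (flabels c)"
  by (simp add: flabels_def)

lemma flabels_subset_iff: "flabels f \<subseteq> S \<longleftrightarrow> (\<forall>t\<in>fset f. tlabels t \<subseteq> S)"
  by (auto simp: flabels_def)

lemma flabels_simps [simp]:
  "flabels {||} = {}" "flabels (f |\<union>| g) = flabels f \<union> flabels g"
  "flabels (finsert t f) = tlabels t \<union> flabels f"
  by (auto simp: flabels_def)

lemma flabels_capp: "flabels (capp c f) = clabels c \<union> flabels f"
  by (induction c) (auto simp: tlabels_Node simp del: tlabels.simps)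

lemma tpaths_Node: "tpaths (Node a c) = insert [a] ((#) a ` fpaths c)"
  by (simp add: fpaths_def)

lemma fpaths_iff:
  "p \<in> fpaths f \<longleftrightarrow> (\<exists>a c. Node a c \<in> fset f \<and> (p = [a] \<or> (\<exists>q\<in>fpaths c. p = a # q)))"
proof -
  have "p \<in> fpaths f \<longleftrightarrow> (\<exists>t\<in>fset f. p \<in> tpaths t)" by (auto simp: fpaths_def)
  also have "\<dots> \<longleftrightarrow> (\<exists>a c. Node a c \<in> fset f \<and> p \<in> tpaths (Node a c))"
    by (metis tree.exhaust)
  finally show ?thesis unfolding tpaths_Node by auto
qed

lemma Nil_notin_fpaths: "[] \<notin> fpaths f"
  by (simp add: fpaths_iff[of "[]"])

lemma singleton_in_fpaths_iff: "[a] \<in> fpaths f \<longleftrightarrow> (\<exists>c. Node a c \<in> fset f)"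
  using Nil_notin_fpaths by (auto simp: fpaths_iff[of "[a]"])

lemma Cons_in_fpaths_iff:
  "q \<noteq> [] \<Longrightarrow> a # q \<in> fpaths f \<longleftrightarrow> (\<exists>c. Node a c \<in> fset f \<and> q \<in> fpaths c)"
  by (auto simp: fpaths_iff[of "a # q"])

text \<open>Relabelling acts letterwise on paths, so equality of path sets survives it even if
  \<open>g\<close> is not injective.\<close>

lemma fpaths_fimage_map_tree: "fpaths (map_tree g |`| f) = map g ` fpaths f"
proof -
  have "tpaths (map_tree g t) = map g ` tpaths t" for t
  proof (induction t)
    case (Node a c)
    have "fpaths (map_tree g |`| c) = map g ` fpaths c"
      using Node by (auto simp: fpaths_def)
    thus ?case unfolding tree.map tpaths_Node by (auto simp: image_iff)
  qed
  thus ?thesis by (auto simp: fpaths_def)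
qed

lemma tlabels_map_tree: "tlabels (map_tree g t) = g ` tlabels t"
  by (induction t) (auto simp: image_iff)

text \<open>A family of trees \<open>a[c]\<close> is recorded as the map \<open>X\<close> sending \<open>a\<close> to the set of values
  of the subforests \<open>c\<close>. The relation says that those trees can be distributed, with
  repetitions and using each of them, over forests whose values form the set \<open>Y\<close>: to a
  forest with value \<open>y\<close> one may assign all trees whose value lies below \<open>y\<close>.\<close>

definition assembles ::
  "'h set \<Rightarrow> ('h \<Rightarrow> 'h \<Rightarrow> 'h) \<Rightarrow> 'v set \<Rightarrow> ('v \<Rightarrow> 'h \<Rightarrow> 'h) \<Rightarrow> ('v \<Rightarrow> 'h set) \<Rightarrow> 'h set \<Rightarrow> bool"
where
  "assembles H pl V ac X Y \<longleftrightarrow>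
     (\<forall>y\<in>Y. \<forall>h\<in>H. (\<forall>a\<in>V. \<forall>x\<in>X a. pl (ac a x) y = y \<longrightarrow> pl (ac a x) h = h) \<longrightarrow> pl y h = h) \<and>
     (\<forall>a\<in>V. \<forall>x\<in>X a. \<exists>y\<in>Y. pl (ac a x) y = y)"

text \<open>\<open>A\<close> stands for the first letters of a path set and \<open>G a\<close> for
  the type of its quotient by \<open>a\<close>; the sets \<open>Y\<close> make up the composed type.
  It is enough that \<open>T\<close> contains them, as \<open>distributive_types\<close> is
  inherited by smaller types. Empty \<open>A\<close> starts the construction, with \<open>Y\<close>
  consisting of the neutral element only.\<close>

definition closed_types ::
  "'h set \<Rightarrow> ('h \<Rightarrow> 'h \<Rightarrow> 'h) \<Rightarrow> 'v set \<Rightarrow> ('v \<Rightarrow> 'h \<Rightarrow> 'h) \<Rightarrow> 'h set set set \<Rightarrow> bool"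
where
  "closed_types H pl V ac C \<longleftrightarrow>
     (\<forall>A\<subseteq>V. \<forall>G. (\<forall>a\<in>A. G a \<in> C) \<longrightarrow>
       (\<exists>T\<in>C. \<forall>X. (\<forall>a\<in>V. X a \<subseteq> H) \<longrightarrow> (\<forall>a\<in>V. if a \<in> A then X a \<in> G a else X a = {}) \<longrightarrow>
          (\<forall>Y\<subseteq>H. Y \<noteq> {} \<longrightarrow> assembles H pl V ac X Y \<longrightarrow> Y \<in> T)))"

definition distributive_types ::
  "'h set \<Rightarrow> ('h \<Rightarrow> 'h \<Rightarrow> 'h) \<Rightarrow> 'v set \<Rightarrow> ('v \<Rightarrow> 'h \<Rightarrow> 'h) \<Rightarrow> 'h set set set \<Rightarrow> bool"
where
  "distributive_types H pl V ac C \<longleftrightarrow>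
     (\<forall>T\<in>C. \<forall>g\<in>H. \<forall>h\<in>H. {g} \<in> T \<longrightarrow> {h} \<in> T \<longrightarrow>
        (\<forall>v\<in>V. ac v (pl g h) = pl (ac v g) (ac v h)))"

text \<open>The elements of \<open>V\<close> are natural numbers so that \<open>V\<close> can itself
  serve as an alphabet, each letter denoting itself.\<close>

locale finite_forest_algebra =
  fixes H :: "'h set" and pl z and V :: "nat set" and mu e ac
  assumes fa: "forest_algebra H pl z V mu e ac" and finite_H: "finite H" and finite_V: "finite V"
begin

lemma z_in [simp]: "z \<in> H" and e_in [simp]: "e \<in> V"
  and pl_in [simp]: "a \<in> H \<Longrightarrow> b \<in> H \<Longrightarrow> pl a b \<in> H"
  and mu_in [simp]: "v \<in> V \<Longrightarrow> w \<in> V \<Longrightarrow> mu v w \<in> V"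
  and ac_in [simp]: "v \<in> V \<Longrightarrow> a \<in> H \<Longrightarrow> ac v a \<in> H"
  and pl_assoc: "a \<in> H \<Longrightarrow> b \<in> H \<Longrightarrow> c \<in> H \<Longrightarrow> pl (pl a b) c = pl a (pl b c)"
  and pl_z [simp]: "a \<in> H \<Longrightarrow> pl z a = a" "a \<in> H \<Longrightarrow> pl a z = a"
  and pl_commute: "a \<in> H \<Longrightarrow> b \<in> H \<Longrightarrow> pl a b = pl b a"
  and pl_idem [simp]: "a \<in> H \<Longrightarrow> pl a a = a"
  and mu_e [simp]: "v \<in> V \<Longrightarrow> mu e v = v" "v \<in> V \<Longrightarrow> mu v e = v"
  and mu_assoc: "u \<in> V \<Longrightarrow> v \<in> V \<Longrightarrow> w \<in> V \<Longrightarrow> mu (mu u v) w = mu u (mu v w)"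
  and ac_mu [simp]: "v \<in> V \<Longrightarrow> w \<in> V \<Longrightarrow> a \<in> H \<Longrightarrow> ac (mu v w) a = ac v (ac w a)"
  and ac_e [simp]: "a \<in> H \<Longrightarrow> ac e a = a"
  using fa unfolding forest_algebra_def by meson+

lemma ac_faithful:
  assumes "v \<in> V" "w \<in> V" "\<And>h. h \<in> H \<Longrightarrow> ac v h = ac w h" shows "v = w"
proof -
  have "\<forall>v\<in>V. \<forall>w\<in>V. (\<forall>h\<in>H. ac v h = ac w h) \<longrightarrow> v = w"
    using fa unfolding forest_algebra_def by (elim conjE)
  thus ?thesis using assms by blast
qed

section \<open>The horizontal monoid as a join semilattice\<close>

lemma pl_left_commute: "a \<in> H \<Longrightarrow> b \<in> H \<Longrightarrow> c \<in> H \<Longrightarrow> pl a (pl b c) = pl b (pl a c)"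
  by (metis pl_assoc pl_commute)

text \<open>In the semilattice order, \<open>pl s h = h\<close> says that \<open>s\<close> lies
  below \<open>h\<close>; so this is the least upper bound of \<open>S\<close>.\<close>

definition is_join :: "'h set \<Rightarrow> 'h \<Rightarrow> bool" where
  "is_join S h \<longleftrightarrow> h \<in> H \<and> (\<forall>s\<in>S. pl s h = h) \<and> (\<forall>g\<in>H. (\<forall>s\<in>S. pl s g = g) \<longrightarrow> pl h g = g)"

definition join :: "'h set \<Rightarrow> 'h" where
  "join S = (THE h. is_join S h)"

lemma join_eqI: "is_join S h \<Longrightarrow> join S = h"
  unfolding join_def by (rule the_equality) (auto simp: is_join_def, metis pl_commute)

lemma is_join_empty: "is_join {} z"
  by (auto simp: is_join_def)

lemma is_join_singleton: "h \<in> H \<Longrightarrow> is_join {h} h"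
  by (auto simp: is_join_def)

lemma is_join_Un:
  assumes "is_join S g" "is_join T h" "S \<subseteq> H" "T \<subseteq> H"
  shows "is_join (S \<union> T) (pl g h)"
  unfolding is_join_def
proof (intro conjI ballI impI)
  have gh: "g \<in> H" "h \<in> H" using assms by (auto simp: is_join_def)
  show "pl g h \<in> H" using gh by simp
  fix s assume "s \<in> S \<union> T"
  thus "pl s (pl g h) = pl g h"
  proof
    assume "s \<in> S"
    thus ?thesis using assms gh by (metis is_join_def pl_assoc subsetD)
  next
    assume "s \<in> T"
    thus ?thesis using assms gh by (metis is_join_def pl_left_commute subsetD)
  qed
next
  fix k assume "k \<in> H" "\<forall>s\<in>S \<union> T. pl s k = k"
  thus "pl (pl g h) k = k" using assms by (simp add: is_join_def pl_assoc)
qed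

lemma is_join_join:
  assumes "finite S" "S \<subseteq> H" shows "is_join S (join S)"
proof -
  have "\<exists>h. is_join S h" using assms
  proof (induction S)
    case empty
    show ?case using is_join_empty by blast
  next
    case (insert s S)
    then obtain h where "is_join S h" by auto
    hence "is_join ({s} \<union> S) (pl s h)"
      using insert.prems by (intro is_join_Un is_join_singleton) auto
    thus ?case by auto
  qed
  thus ?thesis using join_eqI by metis
qed

lemma join_in: "finite S \<Longrightarrow> S \<subseteq> H \<Longrightarrow> join S \<in> H"
  using is_join_join is_join_def by blast

lemma join_Un:
  assumes "finite S" "S \<subseteq> H" "finite T" "T \<subseteq> H"
  shows "join (S \<union> T) = pl (join S) (join T)"
  using assms by (intro join_eqI is_join_Un is_join_join)

section \<open>The tautological morphism on forests and contexts over \<open>V\<close>\<close>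

primrec teval :: "nat tree \<Rightarrow> 'h" where
  "teval (Node a c) = ac a (join (fset (fimage teval c)))"

definition feval :: "nat forest \<Rightarrow> 'h" where
  "feval f = join (teval ` fset f)"

lemma teval_Node: "teval (Node a c) = ac a (feval c)"
  by (simp add: feval_def)

declare teval.simps [simp del]

lemma teval_in: "tlabels t \<subseteq> V \<Longrightarrow> teval t \<in> H"
proof (induction t)
  case (Node a c)
  have "feval c \<in> H"
    unfolding feval_def using Node by (intro join_in) (auto simp: tlabels_Node flabels_subset_iff)
  thus ?case using Node.prems by (simp add: teval_Node)
qed

lemma teval_image: "flabels f \<subseteq> V \<Longrightarrow> teval ` fset f \<subseteq> H"
  using teval_in by (auto simp: flabels_subset_iff)

lemma feval_in [simp]: "flabels f \<subseteq> V \<Longrightarrow> feval f \<in> H"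
  unfolding feval_def using teval_image by (intro join_in) auto

lemma is_join_feval: "flabels f \<subseteq> V \<Longrightarrow> is_join (teval ` fset f) (feval f)"
  unfolding feval_def using teval_image by (intro is_join_join) auto

lemma feval_empty [simp]: "feval {||} = z"
  by (simp add: feval_def join_eqI is_join_empty)

lemma feval_union:
  "flabels f \<subseteq> V \<Longrightarrow> flabels g \<subseteq> V \<Longrightarrow> feval (f |\<union>| g) = pl (feval f) (feval g)"
  using teval_image join_Un by (simp add: feval_def image_Un)

lemma feval_Node:
  "a \<in> V \<Longrightarrow> flabels c \<subseteq> V \<Longrightarrow> feval {|Node a c|} = ac a (feval c)"
  by (simp add: feval_def[of "{|_|}"] teval_Node join_eqI is_join_singleton)

text \<open>This is the element \<open>I_h\<close> of a forest algebra; by faithfulness the choice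
  is unique.\<close>

definition translation :: "'h \<Rightarrow> nat" where
  "translation h = (SOME v. v \<in> V \<and> (\<forall>h'\<in>H. ac v h' = pl h h'))"

lemma translation:
  assumes "h \<in> H"
  shows "translation h \<in> V" "h' \<in> H \<Longrightarrow> ac (translation h) h' = pl h h'"
proof -
  have "\<forall>h\<in>H. \<exists>v\<in>V. \<forall>h'\<in>H. ac v h' = pl h h'"
    using fa unfolding forest_algebra_def by (elim conjE)
  hence "\<exists>v. v \<in> V \<and> (\<forall>h'\<in>H. ac v h' = pl h h')"
    using assms by blast
  from someI_ex[OF this]
  show "translation h \<in> V" "h' \<in> H \<Longrightarrow> ac (translation h) h' = pl h h'"
    by (auto simp: translation_def)
qed

primrec ceval :: "nat ctx \<Rightarrow> nat" where
  "ceval (Hole f) = translation (feval f)"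
| "ceval (CNode f a c) = mu (translation (feval f)) (mu a (ceval c))"

lemma ceval_in: "clabels c \<subseteq> V \<Longrightarrow> ceval c \<in> V"
  by (induction c) (auto simp: translation)

lemma feval_capp:
  "clabels c \<subseteq> V \<Longrightarrow> flabels f \<subseteq> V \<Longrightarrow> feval (capp c f) = ac (ceval c) (feval f)"
proof (induction c)
  case (CNode g a c)
  have lab: "flabels {|Node a (capp c f)|} \<subseteq> V"
    using CNode.prems by (simp add: tlabels_Node flabels_capp del: tlabels.simps)
  have "feval (capp (CNode g a c) f) = pl (feval g) (ac a (feval (capp c f)))"
    using CNode.prems lab by (simp add: feval_union feval_Node flabels_capp del: funion_finsert_right)
  thus ?case using CNode by (simp add: translation ceval_in)
qed (simp add: feval_union translation)

lemma ceval_cadd: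
  assumes "flabels f \<subseteq> V" "clabels c \<subseteq> V"
  shows "ceval (cadd f c) = mu (translation (feval f)) (ceval c)"
proof -
  \<comment> \<open>Both sides act on \<open>H\<close> by adding \<open>g\<close> and
    \<open>h\<close>, so faithfulness identifies them.\<close>
  have tr: "translation (pl g h) = mu (translation g) (translation h)" if "g \<in> H" "h \<in> H" for g h
    using that by (intro ac_faithful) (auto simp: translation pl_assoc)
  show ?thesis using assms
    by (cases c) (auto simp: feval_union tr translation mu_assoc ceval_in)
qed

lemma ceval_ccomp:
  "clabels c \<subseteq> V \<Longrightarrow> clabels d \<subseteq> V \<Longrightarrow> ceval (ccomp c d) = mu (ceval c) (ceval d)"
  by (induction c) (auto simp: ceval_cadd mu_assoc translation ceval_in)

lemma fa_morphism_eval: "fa_morphism V H pl z V mu e ac feval ceval"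
proof -
  have "translation z = e" by (rule ac_faithful) (auto simp: translation)
  thus ?thesis unfolding fa_morphism_def
    by (auto simp: ceval_in feval_union feval_capp ceval_ccomp translation cid_def)
qed

text \<open>Freeness: a morphism is determined by the images \<open>g a\<close> of the one-letter
  contexts. Relabelling along \<open>g\<close> turns it into the tautological evaluation.\<close>

lemma fa_morphism_eq_feval:
  assumes mor: "fa_morphism \<Sigma> H pl z V mu e ac \<phi>H \<phi>V" and f: "flabels f \<subseteq> \<Sigma>"
  defines "g \<equiv> \<lambda>a. \<phi>V (CNode {||} a cid)"
  shows "\<phi>H f = feval (map_tree g |`| f)" "flabels (map_tree g |`| f) \<subseteq> V"
proof -
  have g: "g a \<in> V" if "a \<in> \<Sigma>" for a
    using mor that unfolding fa_morphism_def g_def by (simp add: cid_def)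
  have lab: "tlabels (map_tree g t) \<subseteq> V" if "tlabels t \<subseteq> \<Sigma>" for t
    using that g by (auto simp: tlabels_map_tree)
  have lab': "flabels (map_tree g |`| f) \<subseteq> V" if "flabels f \<subseteq> \<Sigma>" for f
    using that lab by (auto simp: flabels_subset_iff)
  \<comment> \<open>Conditional on the trees of \<open>f\<close>, so that it can serve as a step
    inside the induction on trees below.\<close>
  have forest: "\<phi>H f = feval (map_tree g |`| f)"
    if "flabels f \<subseteq> \<Sigma>" "\<And>t. t \<in> fset f \<Longrightarrow> \<phi>H {|t|} = teval (map_tree g t)" for f
    using that
  proof (induction f)
    case empty
    show ?case using mor by (simp add: fa_morphism_def)
  next
    case (insert t f)
    have "\<phi>H (finsert t f) = \<phi>H ({|t|} |\<union>| f)" by simp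
    also have "\<dots> = pl (\<phi>H {|t|}) (\<phi>H f)"
      using mor insert.prems unfolding fa_morphism_def by (simp del: funion_finsert_left)
    also have "\<dots> = pl (teval (map_tree g t)) (feval (map_tree g |`| f))"
      using insert by simp
    also have "teval (map_tree g t) = feval {|map_tree g t|}"
      using join_eqI[OF is_join_singleton[OF teval_in[OF lab]]] insert.prems
      by (simp add: feval_def)
    also have "pl \<dots> (feval (map_tree g |`| f)) = feval ({|map_tree g t|} |\<union>| map_tree g |`| f)"
      using insert.prems lab lab' by (intro feval_union[symmetric]) auto
    finally show ?case by simp
  qed
  have tree: "\<phi>H {|t|} = teval (map_tree g t)" if "tlabels t \<subseteq> \<Sigma>" for t
    using that
  proof (induction t)
    case (Node a c)
    have c: "flabels c \<subseteq> \<Sigma>" and a: "a \<in> \<Sigma>"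
      using Node.prems by (auto simp: tlabels_Node simp del: tlabels.simps)
    have "\<phi>H {|Node a c|} = \<phi>H (capp (CNode {||} a cid) c)" by (simp add: cid_def)
    also have "\<dots> = ac (g a) (\<phi>H c)"
      using mor a c unfolding fa_morphism_def g_def by (simp add: cid_def del: capp.simps)
    also have "\<phi>H c = feval (map_tree g |`| c)"
      using Node.IH c by (intro forest) (auto simp: flabels_subset_iff)
    finally show ?case by (simp add: teval_Node)
  qed
  show "\<phi>H f = feval (map_tree g |`| f)"
    using f tree by (intro forest) (auto simp: flabels_subset_iff)
  show "flabels (map_tree g |`| f) \<subseteq> V" by (rule lab'[OF f])
qed

text \<open>By freeness it suffices to consider the alphabet \<open>V\<close> with its tautological morphism.\<close>

lemma two_distributive_iff_feval:
  "two_distributive H pl z V mu e ac \<longleftrightarrow>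
     (\<forall>f1 f2. flabels f1 \<subseteq> V \<longrightarrow> flabels f2 \<subseteq> V \<longrightarrow> fpaths f1 = fpaths f2 \<longrightarrow>
        (\<forall>v\<in>V. ac v (pl (feval f1) (feval f2)) = pl (ac v (feval f1)) (ac v (feval f2))))"
    (is "_ \<longleftrightarrow> ?R")
proof
  assume td: "two_distributive H pl z V mu e ac"
  show ?R
  proof (intro allI impI ballI)
    fix f1 f2 v
    assume f: "flabels f1 \<subseteq> V" "flabels f2 \<subseteq> V" "fpaths f1 = fpaths f2" and v: "v \<in> V"
    \<comment> \<open>The context with the single letter \<open>v\<close> above the hole acts as
      \<open>v\<close> itself, so every element of \<open>V\<close> is reached.\<close>
    let ?c = "CNode {||} v cid"
    have capp: "feval (capp ?c f) = ac v (feval f)" if "flabels f \<subseteq> V" for f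
      using that v by (simp add: cid_def feval_Node)
    have c: "clabels ?c \<subseteq> V" using v by (simp add: cid_def)
    have "feval (capp ?c (f1 |\<union>| f2)) = pl (feval (capp ?c f1)) (feval (capp ?c f2))"
      using td fa_morphism_eval finite_V c f unfolding two_distributive_def by blast
    thus "ac v (pl (feval f1) (feval f2)) = pl (ac v (feval f1)) (ac v (feval f2))"
      using capp[of f1] capp[of f2] capp[of "f1 |\<union>| f2"] f by (simp add: feval_union)
  qed
next
  assume R: ?R
  show "two_distributive H pl z V mu e ac"
    unfolding two_distributive_def
  proof (intro allI impI)
    fix \<Sigma> \<phi>H \<phi>V c f1 f2
    assume mor: "fa_morphism \<Sigma> H pl z V mu e ac \<phi>H \<phi>V" and c: "clabels c \<subseteq> \<Sigma>"
      and f: "flabels f1 \<subseteq> \<Sigma>" "flabels f2 \<subseteq> \<Sigma>" "fpaths f1 = fpaths f2"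
    have capp: "\<phi>H (capp c f) = ac (\<phi>V c) (\<phi>H f)" if "flabels f \<subseteq> \<Sigma>" for f
      using mor c that unfolding fa_morphism_def by blast
    have un: "\<phi>H (f1 |\<union>| f2) = pl (\<phi>H f1) (\<phi>H f2)"
      using mor f unfolding fa_morphism_def by blast
    have cV: "\<phi>V c \<in> V" using mor c unfolding fa_morphism_def by blast
    define g where "g = map_tree (\<lambda>a. \<phi>V (CNode {||} a cid))"
    note g = fa_morphism_eq_feval[OF mor, folded g_def]
    have "fpaths (g |`| f1) = fpaths (g |`| f2)"
      unfolding g_def fpaths_fimage_map_tree f(3) ..
    hence "ac (\<phi>V c) (pl (\<phi>H f1) (\<phi>H f2)) = pl (ac (\<phi>V c) (\<phi>H f1)) (ac (\<phi>V c) (\<phi>H f2))"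
      unfolding g(1)[OF f(1)] g(1)[OF f(2)] using R g(2)[OF f(1)] g(2)[OF f(2)] cV by blast
    thus "\<phi>H (capp c (f1 |\<union>| f2)) = pl (\<phi>H (capp c f1)) (\<phi>H (capp c f2))"
      using capp[of f1] capp[of f2] capp[of "f1 |\<union>| f2"] f un by simp
  qed
qed

section \<open>Composition and decomposition of types along first letters\<close>

definition cover_type :: "nat list set \<Rightarrow> 'h set set" where
  "cover_type L = {feval ` F | F. finite F \<and> F \<noteq> {} \<and> (\<forall>f\<in>F. flabels f \<subseteq> V) \<and> \<Union> (fpaths ` F) = L}"

text \<open>The empty path is excluded because path sets contain nonempty paths only; whether
  \<open>[a]\<close> belongs to \<open>L\<close> is recorded separately.\<close>

definition path_quotient :: "nat list set \<Rightarrow> nat \<Rightarrow> nat list set" where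
  "path_quotient L a = {p. p \<noteq> [] \<and> a # p \<in> L}"

text \<open>Cutting off the roots: the forests found below roots \<open>a\<close> in the family
  cover the quotient by \<open>a\<close>. Each tree lies below the value of its own forest, and that
  value is the join of its trees, whence \<open>assembles\<close>.\<close>

lemma cover_type_decompose:
  assumes "Y \<in> cover_type L"
  obtains X where "\<forall>a\<in>V. X a \<subseteq> H"
    "\<forall>a\<in>V. if [a] \<in> L then X a \<in> cover_type (path_quotient L a) else X a = {}"
    "assembles H pl V ac X Y" "Y \<subseteq> H" "Y \<noteq> {}"
proof -
  obtain F where F: "finite F" "F \<noteq> {}" "\<And>f. f \<in> F \<Longrightarrow> flabels f \<subseteq> V" "\<Union> (fpaths ` F) = L"
    and Y: "Y = feval ` F"
    using assms unfolding cover_type_def by blast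
  define K where "K a = {c. \<exists>f\<in>F. Node a c \<in> fset f}" for a
  define X where "X a = feval ` K a" for a
  have K_lab: "a \<in> V" "flabels c \<subseteq> V" if "f \<in> F" "Node a c \<in> fset f" for a c f
  proof -
    have "tlabels (Node a c) \<subseteq> V" using F(3)[OF that(1), unfolded flabels_subset_iff] that(2) by blast
    thus "a \<in> V" "flabels c \<subseteq> V" by (auto simp: tlabels_Node simp del: tlabels.simps)
  qed
  have X: "X a \<subseteq> H" "if [a] \<in> L then X a \<in> cover_type (path_quotient L a) else X a = {}" for a
  proof -
    have Ka: "flabels c \<subseteq> V" if "c \<in> K a" for c
      using that K_lab(2) unfolding K_def by auto
    show "X a \<subseteq> H" unfolding X_def using Ka feval_in by auto
    have "K a \<subseteq> (\<lambda>t. case t of Node _ c \<Rightarrow> c) ` (\<Union>f\<in>F. fset f)"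
      unfolding K_def by (force simp: image_iff)
    hence fin: "finite (K a)" by (rule finite_subset) (use F(1) in auto)
    have ne: "[a] \<in> L \<longleftrightarrow> K a \<noteq> {}"
      unfolding K_def F(4)[symmetric] UN_iff singleton_in_fpaths_iff by blast
    have "\<Union> (fpaths ` K a) = path_quotient L a"
    proof (intro set_eqI)
      fix p
      show "p \<in> \<Union> (fpaths ` K a) \<longleftrightarrow> p \<in> path_quotient L a"
      proof (cases "p = []")
        case False
        thus ?thesis unfolding path_quotient_def F(4)[symmetric] K_def
          by (auto simp: Cons_in_fpaths_iff)
      qed (auto simp: Nil_notin_fpaths path_quotient_def)
    qed
    thus "if [a] \<in> L then X a \<in> cover_type (path_quotient L a) else X a = {}"
      using fin ne Ka unfolding X_def cover_type_def by simp blast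
  qed
  show ?thesis
  proof
    show "\<forall>a\<in>V. X a \<subseteq> H"
      "\<forall>a\<in>V. if [a] \<in> L then X a \<in> cover_type (path_quotient L a) else X a = {}"
      using X by blast+
    have join: "is_join (teval ` fset f) (feval f)" if "f \<in> F" for f
      using that F(3) is_join_feval by blast
    show "assembles H pl V ac X Y"
      unfolding assembles_def
    proof (intro conjI ballI impI)
      fix y h assume y: "y \<in> Y" and h: "h \<in> H"
        and up: "\<forall>a\<in>V. \<forall>x\<in>X a. pl (ac a x) y = y \<longrightarrow> pl (ac a x) h = h"
      obtain f where f: "f \<in> F" "y = feval f" using y Y by blast
      \<comment> \<open>Every tree of \<open>f\<close> is among the trees below \<open>y\<close>, so
        an upper bound of the latter bounds the former.\<close>
      have "pl (teval t) h = h" if "t \<in> fset f" for t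
      proof -
        obtain a c where t: "t = Node a c" by (cases t)
        have "a \<in> V" "feval c \<in> X a" using f t that K_lab unfolding X_def K_def by blast+
        moreover have "pl (teval t) y = y" using join[OF f(1)] f(2) that by (auto simp: is_join_def)
        ultimately show ?thesis using up t by (simp add: teval_Node)
      qed
      thus "pl y h = h" using join[OF f(1)] f(2) h by (auto simp: is_join_def)
    next
      fix a x assume "a \<in> V" "x \<in> X a"
      then obtain f c where "f \<in> F" "Node a c \<in> fset f" "x = feval c"
        unfolding X_def K_def by blast
      hence "pl (ac a x) (feval f) = feval f"
        using join[of f] by (force simp: is_join_def teval_Node)
      thus "\<exists>y\<in>Y. pl (ac a x) y = y" using Y \<open>f \<in> F\<close> by blast
    qed
    show "Y \<subseteq> H" "Y \<noteq> {}" using Y F feval_in by auto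
  qed
qed

text \<open>Each \<open>y\<close> is realised by the forest of all available trees with value below
  \<open>y\<close>. The first clause of \<open>assembles\<close> makes its value equal to
  \<open>y\<close>, the second ensures that no tree is lost, so the path sets have the prescribed
  union.\<close>

lemma cover_type_compose:
  assumes A: "A \<subseteq> V" and X: "\<And>a. a \<in> V \<Longrightarrow> if a \<in> A then X a \<in> cover_type (Q a) else X a = {}"
    and Y: "assembles H pl V ac X Y" "Y \<subseteq> H" "Y \<noteq> {}"
  shows "Y \<in> cover_type (\<Union>a\<in>A. insert [a] ((#) a ` Q a))"
proof -
  have "\<forall>a\<in>A. \<exists>F. finite F \<and> F \<noteq> {} \<and> (\<forall>f\<in>F. flabels f \<subseteq> V) \<and>
    \<Union> (fpaths ` F) = Q a \<and> X a = feval ` F"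
  proof
    fix a assume "a \<in> A"
    hence "X a \<in> cover_type (Q a)" using X[of a] A by auto
    thus "\<exists>F. finite F \<and> F \<noteq> {} \<and> (\<forall>f\<in>F. flabels f \<subseteq> V) \<and>
      \<Union> (fpaths ` F) = Q a \<and> X a = feval ` F"
      unfolding cover_type_def by blast
  qed
  from bchoice[OF this] obtain K where K': "\<forall>a\<in>A. finite (K a) \<and> K a \<noteq> {} \<and>
      (\<forall>f\<in>K a. flabels f \<subseteq> V) \<and> \<Union> (fpaths ` K a) = Q a \<and> X a = feval ` K a" ..
  have K: "\<And>a. a \<in> A \<Longrightarrow> finite (K a)" "\<And>a. a \<in> A \<Longrightarrow> K a \<noteq> {}"
    "\<And>a c. a \<in> A \<Longrightarrow> c \<in> K a \<Longrightarrow> flabels c \<subseteq> V"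
    "\<And>a. a \<in> A \<Longrightarrow> \<Union> (fpaths ` K a) = Q a" "\<And>a. a \<in> A \<Longrightarrow> X a = feval ` K a"
    using K' by simp_all
  define S where "S y = {Node a c | a c. a \<in> A \<and> c \<in> K a \<and> pl (ac a (feval c)) y = y}" for y
  have S_iff: "Node a c \<in> S y \<longleftrightarrow> a \<in> A \<and> c \<in> K a \<and> pl (ac a (feval c)) y = y" for a c y
    unfolding S_def by simp
  define F where "F y = Abs_fset (S y)" for y
  have "finite (S y)" for y
  proof (rule finite_subset)
    show "S y \<subseteq> (\<Union>a\<in>A. Node a ` K a)" unfolding S_def by blast
    show "finite (\<Union>a\<in>A. Node a ` K a)" using A finite_V K(1) finite_subset by blast
  qed
  hence fset_F: "fset (F y) = S y" for y by (simp add: F_def Abs_fset_inverse)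
  have lab: "flabels (F y) \<subseteq> V" for y
    unfolding flabels_subset_iff fset_F
  proof
    fix t assume "t \<in> S y"
    then obtain a c where "t = Node a c" "a \<in> A" "c \<in> K a" unfolding S_def by blast
    thus "tlabels t \<subseteq> V" using A K(3)[of a c] by (auto simp only: tlabels_Node)
  qed
  have val: "feval (F y) = y" if y: "y \<in> Y" for y
    unfolding feval_def fset_F
  proof (rule join_eqI)
    have "\<forall>a\<in>V. \<forall>x\<in>X a. pl (ac a x) y = y \<longrightarrow> pl (ac a x) h = h"
      if h: "\<forall>s\<in>teval ` S y. pl s h = h" for h
    proof (intro ballI impI)
      fix a x assume a: "a \<in> V" "x \<in> X a" "pl (ac a x) y = y"
      \<comment> \<open>For a letter outside \<open>A\<close> the set \<open>X a\<close> would be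
        empty.\<close>
      hence "a \<in> A" using X[of a] by (auto split: if_splits)
      with a K(5) obtain c where "c \<in> K a" "x = feval c" by auto
      with a \<open>a \<in> A\<close> have "Node a c \<in> S y" "teval (Node a c) = ac a x"
        by (auto simp: S_def teval_Node)
      thus "pl (ac a x) h = h" using h by force
    qed
    thus "is_join (teval ` S y) y"
      using Y y unfolding is_join_def assembles_def by (auto simp: S_def teval_Node)
  qed
  have img: "feval ` (F ` Y) = Y" using val by force
  have "p \<in> \<Union> (fpaths ` F ` Y) \<longleftrightarrow> p \<in> (\<Union>a\<in>A. insert [a] ((#) a ` Q a))" for p
  proof -
    have used: "\<exists>y\<in>Y. pl (ac a (feval c)) y = y" if "a \<in> A" "c \<in> K a" for a c
      using Y(1) A K(5) that unfolding assembles_def by blast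
    have "p \<in> \<Union> (fpaths ` F ` Y) \<longleftrightarrow>
        (\<exists>y\<in>Y. \<exists>a c. Node a c \<in> S y \<and> (p = [a] \<or> (\<exists>q\<in>fpaths c. p = a # q)))"
      by (simp add: fpaths_iff[of p] fset_F)
    also have "\<dots> \<longleftrightarrow> (\<exists>a\<in>A. \<exists>c\<in>K a. p = [a] \<or> (\<exists>q\<in>fpaths c. p = a # q))"
      unfolding S_iff using used by metis
    also have "\<dots> \<longleftrightarrow> (\<exists>a\<in>A. p = [a] \<or> (\<exists>q\<in>Q a. p = a # q))"
    proof (rule bex_cong[OF refl])
      fix a assume "a \<in> A"
      show "(\<exists>c\<in>K a. p = [a] \<or> (\<exists>q\<in>fpaths c. p = a # q)) \<longleftrightarrow> p = [a] \<or> (\<exists>q\<in>Q a. p = a # q)"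
        \<comment> \<open>Nonemptiness of \<open>K a\<close> yields the path \<open>[a]\<close> even
          when \<open>Q a\<close> is empty.\<close>
        using K(2)[OF \<open>a \<in> A\<close>] unfolding K(4)[OF \<open>a \<in> A\<close>, symmetric] by blast
    qed
    finally show ?thesis by blast
  qed
  hence "\<Union> (fpaths ` F ` Y) = (\<Union>a\<in>A. insert [a] ((#) a ` Q a))" by (rule set_eqI)
  moreover have "finite (F ` Y)" using Y(2) finite_H finite_subset by blast
  ultimately show ?thesis
    unfolding cover_type_def using img lab Y(3) by (intro CollectI exI[of _ "F ` Y"]) simp
qed

text \<open>Induction on a bound for the path lengths: passing to a quotient shortens all paths, and
  closure combines the types found for the quotients. Inclusion propagates since enlarging
  \<open>G a\<close> only admits more maps \<open>X\<close>.\<close>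

lemma closed_types_cover:
  assumes C: "closed_types H pl V ac C"
  shows "(\<And>p. p \<in> L \<Longrightarrow> length p \<le> N) \<Longrightarrow> \<exists>T\<in>C. cover_type L \<subseteq> T"
proof (induction N arbitrary: L rule: less_induct)
  case (less N)
  let ?A = "{a \<in> V. [a] \<in> L}"
  have "\<exists>T\<in>C. cover_type (path_quotient L a) \<subseteq> T" if "a \<in> ?A" for a
  proof (rule less.IH[of "N - 1"])
    \<comment> \<open>The path \<open>[a]\<close> has length 1, so \<open>N\<close> is
      positive.\<close>
    show "N - 1 < N" using that less.prems[of "[a]"] by simp
    show "length p \<le> N - 1" if "p \<in> path_quotient L a" for p
      using that less.prems[of "a # p"] by (auto simp: path_quotient_def)
  qed
  hence "\<forall>a\<in>?A. \<exists>T. T \<in> C \<and> cover_type (path_quotient L a) \<subseteq> T" by blast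
  from bchoice[OF this] obtain G where G: "\<And>a. a \<in> ?A \<Longrightarrow> G a \<in> C"
    "\<And>a. a \<in> ?A \<Longrightarrow> cover_type (path_quotient L a) \<subseteq> G a"
    by blast
  have "\<exists>T\<in>C. \<forall>X. (\<forall>a\<in>V. X a \<subseteq> H) \<longrightarrow> (\<forall>a\<in>V. if a \<in> ?A then X a \<in> G a else X a = {}) \<longrightarrow>
          (\<forall>Y\<subseteq>H. Y \<noteq> {} \<longrightarrow> assembles H pl V ac X Y \<longrightarrow> Y \<in> T)"
    using C[unfolded closed_types_def, rule_format, of ?A G] G(1) by auto
  then obtain T where T: "T \<in> C"
    "\<forall>X. (\<forall>a\<in>V. X a \<subseteq> H) \<longrightarrow> (\<forall>a\<in>V. if a \<in> ?A then X a \<in> G a else X a = {}) \<longrightarrow>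
      (\<forall>Y\<subseteq>H. Y \<noteq> {} \<longrightarrow> assembles H pl V ac X Y \<longrightarrow> Y \<in> T)" ..
  have "cover_type L \<subseteq> T"
  proof
    fix Y assume "Y \<in> cover_type L"
    then obtain X where X: "\<forall>a\<in>V. X a \<subseteq> H"
      "\<forall>a\<in>V. if [a] \<in> L then X a \<in> cover_type (path_quotient L a) else X a = {}"
      "assembles H pl V ac X Y" "Y \<subseteq> H" "Y \<noteq> {}"
      by (rule cover_type_decompose)
    have "\<forall>a\<in>V. if a \<in> ?A then X a \<in> G a else X a = {}"
      using X(2) G(2) by (auto split: if_splits)
    with T(2)[rule_format, of X Y] X show "Y \<in> T" by simp
  qed
  thus ?case using T(1) by blast
qed

text \<open>Given sets \<open>Q a\<close> whose types are the \<open>G a\<close>, the path set with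
  first letters \<open>A\<close> and continuations \<open>Q a\<close> has a type containing the
  composed one.\<close>

lemma closed_types_range_cover_type: "closed_types H pl V ac (range cover_type)"
  unfolding closed_types_def
proof (intro allI impI)
  fix A G assume A: "A \<subseteq> V" and "\<forall>a\<in>A. G a \<in> range cover_type"
  hence "\<forall>a\<in>A. \<exists>L. G a = cover_type L" by blast
  then obtain Q where Q: "\<forall>a\<in>A. G a = cover_type (Q a)" by metis
  let ?L = "\<Union>a\<in>A. insert [a] ((#) a ` Q a)"
  show "\<exists>T\<in>range cover_type. \<forall>X. (\<forall>a\<in>V. X a \<subseteq> H) \<longrightarrow>
          (\<forall>a\<in>V. if a \<in> A then X a \<in> G a else X a = {}) \<longrightarrow>
          (\<forall>Y\<subseteq>H. Y \<noteq> {} \<longrightarrow> assembles H pl V ac X Y \<longrightarrow> Y \<in> T)"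
  proof (intro bexI[of _ "cover_type ?L"] allI impI)
    fix X Y assume "\<forall>a\<in>V. if a \<in> A then X a \<in> G a else X a = {}"
      "Y \<subseteq> H" "Y \<noteq> {}" "assembles H pl V ac X Y"
    thus "Y \<in> cover_type ?L" using A Q by (intro cover_type_compose) auto
  qed simp
qed

text \<open>If all forests of a family have value \<open>h\<close>, so has their union, by
  idempotence; its path set is the union of theirs. Hence singletons in a type are values of single
  forests.\<close>

lemma singleton_in_cover_type:
  assumes "{h} \<in> cover_type L"
  obtains f where "flabels f \<subseteq> V" "fpaths f = L" "feval f = h"
proof -
  obtain F where F: "finite F" "F \<noteq> {}" "\<And>f. f \<in> F \<Longrightarrow> flabels f \<subseteq> V" "\<Union> (fpaths ` F) = L"
    "feval ` F = {h}"
    using assms unfolding cover_type_def by auto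
  have "\<exists>f. flabels f \<subseteq> V \<and> fpaths f = \<Union> (fpaths ` F) \<and> feval f = h"
    using F(1,2,3,5)
  proof (induction F rule: finite_ne_induct)
    case (singleton f)
    thus ?case by auto
  next
    case (insert f F)
    from insert.prems have f: "feval f = h" "flabels f \<subseteq> V" by auto
    have "feval ` F \<subseteq> {h}" "feval ` F \<noteq> {}" using insert.prems(2) insert.hyps(2) by auto
    hence "feval ` F = {h}" by blast
    then obtain g where g: "flabels g \<subseteq> V" "fpaths g = \<Union> (fpaths ` F)" "feval g = h"
      using insert by auto
    have "fpaths (f |\<union>| g) = fpaths f \<union> fpaths g" by (auto simp: fpaths_def)
    moreover have "feval (f |\<union>| g) = h" using f g feval_in[of f] by (simp add: feval_union)
    ultimately show ?case using f g by (intro exI[of _ "f |\<union>| g"]) auto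
  qed
  thus ?thesis using that F(4) by auto
qed

lemma fpaths_bounded: "\<exists>N. \<forall>p\<in>fpaths f. length p \<le> N"
proof -
  have tree: "finite (tpaths t)" for t
    by (induction t) auto
  have "finite (fpaths f)" unfolding fpaths_def by (intro finite_UN_I finite_fset tree)
  hence "\<forall>p\<in>fpaths f. length p \<le> Max (length ` fpaths f)" by simp
  thus ?thesis by blast
qed

text \<open>For necessity, \<open>C\<close> is the set of all types. For sufficiency, the type of
  the common path set lies below some member of \<open>C\<close>, which then contains the singletons
  of both values. Since \<open>Pow (Pow H)\<close> is finite, the search for \<open>C\<close> is
  finite.\<close>

theorem two_distributive_iff_types:
  "two_distributive H pl z V mu e ac \<longleftrightarrow>
     (\<exists>C\<subseteq>Pow (Pow H). closed_types H pl V ac C \<and> distributive_types H pl V ac C)"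
  unfolding two_distributive_iff_feval
proof (intro iffI allI impI ballI)
  assume R: "\<forall>f1 f2. flabels f1 \<subseteq> V \<longrightarrow> flabels f2 \<subseteq> V \<longrightarrow> fpaths f1 = fpaths f2 \<longrightarrow>
    (\<forall>v\<in>V. ac v (pl (feval f1) (feval f2)) = pl (ac v (feval f1)) (ac v (feval f2)))"
  have "distributive_types H pl V ac (range cover_type)"
    unfolding distributive_types_def
  proof (intro ballI impI)
    fix T g h v assume "T \<in> range cover_type" and gh: "{g} \<in> T" "{h} \<in> T" and v: "v \<in> V"
    then obtain L where L: "{g} \<in> cover_type L" "{h} \<in> cover_type L" by auto
    obtain f1 where "flabels f1 \<subseteq> V" "fpaths f1 = L" "feval f1 = g"
      using singleton_in_cover_type[OF L(1)] .
    moreover obtain f2 where "flabels f2 \<subseteq> V" "fpaths f2 = L" "feval f2 = h"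
      using singleton_in_cover_type[OF L(2)] .
    ultimately show "ac v (pl g h) = pl (ac v g) (ac v h)" using R v by blast
  qed
  moreover have "range cover_type \<subseteq> Pow (Pow H)"
    unfolding cover_type_def using feval_in by blast
  ultimately show "\<exists>C\<subseteq>Pow (Pow H). closed_types H pl V ac C \<and> distributive_types H pl V ac C"
    using closed_types_range_cover_type by blast
next
  fix f1 f2 v
  assume "\<exists>C\<subseteq>Pow (Pow H). closed_types H pl V ac C \<and> distributive_types H pl V ac C"
    and f: "flabels f1 \<subseteq> V" "flabels f2 \<subseteq> V" "fpaths f1 = fpaths f2" and v: "v \<in> V"
  then obtain C where C: "closed_types H pl V ac C" "distributive_types H pl V ac C" by blast
  obtain N where "\<forall>p\<in>fpaths f1. length p \<le> N" using fpaths_bounded by blast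
  then obtain T where T: "T \<in> C" "cover_type (fpaths f1) \<subseteq> T"
    using closed_types_cover[OF C(1)] by blast
  have "{feval f} \<in> cover_type (fpaths f)" if "flabels f \<subseteq> V" for f
    unfolding cover_type_def using that by (intro CollectI exI[of _ "{f}"]) auto
  from this[of f1] this[of f2] have "{feval f1} \<in> T" "{feval f2} \<in> T" using f T(2) by auto
  thus "ac v (pl (feval f1) (feval f2)) = pl (ac v (feval f1)) (ac v (feval f2))"
    using C(2) T(1) f v unfolding distributive_types_def by simp
qed

end

section \<open>Arithmetization\<close>

lemma less_power2_iff_set_decode: "s < 2 ^ N \<longleftrightarrow> set_decode s \<subseteq> {..<N}"
proof
  assume s: "s < 2 ^ N"
  show "set_decode s \<subseteq> {..<N}"
  proof
    fix i assume "i \<in> set_decode s"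
    hence "s div 2 ^ i \<noteq> 0" by (auto simp: set_decode_def intro: ccontr)
    hence "2 ^ i \<le> s" by (simp add: div_eq_0_iff)
    hence "(2::nat) ^ i < 2 ^ N" using s by (rule le_less_trans)
    thus "i \<in> {..<N}" by simp
  qed
next
  assume "set_decode s \<subseteq> {..<N}"
  hence "sum ((^) 2) (set_decode s) \<le> sum ((^) (2::nat)) {..<N}" by (intro sum_mono2) auto
  also have "\<dots> < 2 ^ N" by (induction N) auto
  finally show "s < 2 ^ N" by (metis finite_set_decode set_decode_inverse set_encode_def)
qed

lemma ex_code_of_set:
  assumes "S \<subseteq> {..<N}" obtains s where "s < 2 ^ N" "set_decode s = S"
proof
  have "finite S" using assms finite_subset by blast
  thus "set_decode (set_encode S) = S" by simp
  thus "set_encode S < 2 ^ N" using assms by (simp add: less_power2_iff_set_decode)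
qed

lemma set_decode_image_lessThan: "set_decode ` {..<2 ^ N} = Pow {..<N}"
proof
  show "Pow {..<N} \<subseteq> set_decode ` {..<2 ^ N}"
  proof
    fix S assume "S \<in> Pow {..<N}"
    then obtain s where "s < 2 ^ N" "set_decode s = S" using ex_code_of_set[of S N] by auto
    thus "S \<in> set_decode ` {..<2 ^ N}" by auto
  qed
qed (auto simp: less_power2_iff_set_decode)

lemma inj_set_decode: "inj set_decode"
  by (metis injI set_decode_inverse)

definition decode_type :: "nat \<Rightarrow> nat set set" where
  "decode_type t = set_decode ` set_decode t"

lemma inj_decode_type: "inj decode_type"
  unfolding decode_type_def using inj_set_decode by (auto simp: inj_def inj_image_eq_iff)

lemma decode_type_image_lessThan: "decode_type ` {..<2 ^ 2 ^ n} = Pow (Pow {..<n})"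
proof -
  have "decode_type ` {..<2 ^ 2 ^ n} = (`) set_decode ` set_decode ` {..<2 ^ 2 ^ n}"
    by (simp add: decode_type_def image_image)
  also have "\<dots> = Pow (set_decode ` {..<2 ^ n})"
    by (simp add: set_decode_image_lessThan image_Pow_surj)
  finally show ?thesis by (simp add: set_decode_image_lessThan)
qed

definition decode_types :: "nat \<Rightarrow> nat set set set" where
  "decode_types c = decode_type ` set_decode c"

text \<open>Each level of sets costs one exponential; this bounds the search for \<open>c\<close> in
  the criterion.\<close>

lemma decode_types_image_lessThan:
  "decode_types ` {..<2 ^ 2 ^ 2 ^ n} = Pow (Pow (Pow {..<n}))"
proof -
  have "decode_types ` {..<2 ^ 2 ^ 2 ^ n} = (`) decode_type ` set_decode ` {..<2 ^ 2 ^ 2 ^ n}"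
    by (simp add: decode_types_def image_image)
  also have "\<dots> = Pow (decode_type ` {..<2 ^ 2 ^ n})"
    by (simp add: set_decode_image_lessThan image_Pow_surj)
  finally show ?thesis by (simp add: decode_type_image_lessThan)
qed

lemma set_decode_in_decode_type: "set_decode y \<in> decode_type t \<longleftrightarrow> y \<in> set_decode t"
  by (simp add: decode_type_def inj_image_mem_iff inj_set_decode)

lemma decode_type_in_decode_types: "decode_type t \<in> decode_types c \<longleftrightarrow> t \<in> set_decode c"
  by (simp add: decode_types_def inj_image_mem_iff inj_decode_type)

text \<open>A family of subsets of \<open>{..<w}\<close> indexed by \<open>a < m\<close> is coded by a single number whose
  binary expansion consists of \<open>m\<close> blocks of \<open>w\<close> bits.\<close>

definition row :: "nat \<Rightarrow> nat \<Rightarrow> nat \<Rightarrow> nat set" where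
  "row w g a = {y. y < w \<and> a * w + y \<in> set_decode g}"

lemma row_subset: "row w g a \<subseteq> {..<w}"
  by (auto simp: row_def)

lemma ex_code_of_family:
  assumes "\<And>a. a < m \<Longrightarrow> F a \<subseteq> {..<w}"
  obtains g where "g < 2 ^ (m * w)" "\<And>a. a < m \<Longrightarrow> row w g a = F a"
proof -
  \<comment> \<open>Position \<open>i\<close> lies in block \<open>i div w\<close> at offset
    \<open>i mod w\<close>.\<close>
  let ?S = "{i. i < m * w \<and> i mod w \<in> F (i div w)}"
  have "?S \<subseteq> {..<m * w}" by auto
  then obtain g where g: "g < 2 ^ (m * w)" "set_decode g = ?S" by (rule ex_code_of_set)
  have "row w g a = F a" if "a < m" for a
  proof -
    have "a * w + y < m * w" if "y < w" for y
    proof -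
      have "a * w + y < Suc a * w" using that by simp
      also have "\<dots> \<le> m * w" using \<open>a < m\<close> by (intro mult_le_mono1) simp
      finally show ?thesis .
    qed
    thus ?thesis using assms[OF \<open>a < m\<close>] by (auto simp: row_def g(2))
  qed
  thus ?thesis using that g(1) by blast
qed

section \<open>The criterion as a bounded arithmetic formula\<close>

definition coded_assembles ::
  "nat \<Rightarrow> (nat \<Rightarrow> nat \<Rightarrow> nat) \<Rightarrow> nat \<Rightarrow> (nat \<Rightarrow> nat \<Rightarrow> nat) \<Rightarrow> nat \<Rightarrow> nat \<Rightarrow> bool"
where
  "coded_assembles n pl m ac X Y \<longleftrightarrow>
     (\<forall>y<n. y \<in> set_decode Y \<longrightarrow> (\<forall>h<n.
        (\<forall>a<m. \<forall>x<n. a * n + x \<in> set_decode X \<longrightarrow> pl (ac a x) y = y \<longrightarrow> pl (ac a x) h = h) \<longrightarrow>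
        pl y h = h)) \<and>
     (\<forall>a<m. \<forall>x<n. a * n + x \<in> set_decode X \<longrightarrow> (\<exists>y<n. y \<in> set_decode Y \<and> pl (ac a x) y = y))"

text \<open>\<open>A\<close> codes a set of letters. \<open>G\<close> has a block of
  \<open>2 ^ n\<close> bits per letter, one for each code of a subset of \<open>{..<n}\<close>, and
  so holds a family of types; \<open>X\<close> has blocks of \<open>n\<close> bits and holds a
  family of subsets.\<close>

definition coded_closed ::
  "nat \<Rightarrow> (nat \<Rightarrow> nat \<Rightarrow> nat) \<Rightarrow> nat \<Rightarrow> (nat \<Rightarrow> nat \<Rightarrow> nat) \<Rightarrow> nat \<Rightarrow> bool"
where
  "coded_closed n pl m ac c \<longleftrightarrow>
     (\<forall>A<2 ^ m. \<forall>G<2 ^ (m * 2 ^ n).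
       (\<forall>a<m. a \<in> set_decode A \<longrightarrow>
         (\<exists>t<2 ^ 2 ^ n. t \<in> set_decode c \<and>
            (\<forall>y<2 ^ n. y \<in> set_decode t \<longleftrightarrow> a * 2 ^ n + y \<in> set_decode G))) \<longrightarrow>
       (\<exists>t<2 ^ 2 ^ n. t \<in> set_decode c \<and>
         (\<forall>X<2 ^ (m * n).
           (\<forall>a<m. (a \<in> set_decode A \<longrightarrow>
                (\<exists>y<2 ^ n. a * 2 ^ n + y \<in> set_decode G \<and>
                   (\<forall>x<n. x \<in> set_decode y \<longleftrightarrow> a * n + x \<in> set_decode X))) \<and>
              (a \<notin> set_decode A \<longrightarrow> (\<forall>x<n. a * n + x \<notin> set_decode X))) \<longrightarrow>
           (\<forall>Y<2 ^ n. Y \<noteq> 0 \<longrightarrow> coded_assembles n pl m ac X Y \<longrightarrow> Y \<in> set_decode t))))"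

text \<open>The number \<open>2 ^ g\<close> is the code of the singleton of
  \<open>g\<close>.\<close>

definition coded_distributive ::
  "nat \<Rightarrow> (nat \<Rightarrow> nat \<Rightarrow> nat) \<Rightarrow> nat \<Rightarrow> (nat \<Rightarrow> nat \<Rightarrow> nat) \<Rightarrow> nat \<Rightarrow> bool"
where
  "coded_distributive n pl m ac c \<longleftrightarrow>
     (\<forall>t<2 ^ 2 ^ n. t \<in> set_decode c \<longrightarrow>
       (\<forall>g<n. \<forall>h<n. 2 ^ g \<in> set_decode t \<longrightarrow> 2 ^ h \<in> set_decode t \<longrightarrow>
          (\<forall>v<m. ac v (pl g h) = pl (ac v g) (ac v h))))"

lemma coded_assembles_iff:
  assumes "Y < 2 ^ n"
  shows "coded_assembles n pl m ac X Y \<longleftrightarrow>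
    assembles {..<n} pl {..<m} ac (row n X) (set_decode Y)"
  using assms unfolding less_power2_iff_set_decode coded_assembles_def assembles_def row_def
  by (simp add: Ball_def Bex_def subset_iff) blast

lemma assembles_cong:
  assumes "\<And>a. a \<in> V \<Longrightarrow> X a = X' a"
  shows "assembles H pl V ac X Y \<longleftrightarrow> assembles H pl V ac X' Y"
  using assms unfolding assembles_def by simp

text \<open>Codes below the given bounds reach all sets and families that matter, so the quantifiers
  on the two sides translate into each other one by one.\<close>

lemma coded_closed_iff:
  assumes c: "c < 2 ^ 2 ^ 2 ^ n"
  shows "coded_closed n pl m ac c \<longleftrightarrow> closed_types {..<n} pl {..<m} ac (decode_types c)"
proof -
  have c_less: "t < 2 ^ 2 ^ n" if "t \<in> set_decode c" for t
    using c that unfolding less_power2_iff_set_decode[of c] by blast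
  have row_eq_iff: "(\<forall>y<w. y \<in> set_decode t \<longleftrightarrow> a * w + y \<in> set_decode G) \<longleftrightarrow> set_decode t = row w G a"
    if "t < 2 ^ w" for w t a G
    using that unfolding less_power2_iff_set_decode row_def by auto
  have G_iff: "(\<exists>t<2 ^ 2 ^ n. t \<in> set_decode c \<and>
      (\<forall>y<2 ^ n. y \<in> set_decode t \<longleftrightarrow> a * 2 ^ n + y \<in> set_decode G)) \<longleftrightarrow>
      set_decode ` row (2 ^ n) G a \<in> decode_types c" (is "?L \<longleftrightarrow> ?R") for a G
  proof -
    have "?L \<longleftrightarrow> (\<exists>t\<in>set_decode c. set_decode t = row (2 ^ n) G a)"
      using c_less row_eq_iff by blast
    also have "\<dots> \<longleftrightarrow> ?R"
      unfolding decode_types_def decode_type_def image_iff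
      by (metis inj_image_eq_iff inj_set_decode)
    finally show ?thesis .
  qed
  have X_iff: "(\<exists>y<2 ^ n. a * 2 ^ n + y \<in> set_decode G \<and>
      (\<forall>x<n. x \<in> set_decode y \<longleftrightarrow> a * n + x \<in> set_decode X)) \<longleftrightarrow>
      row n X a \<in> set_decode ` row (2 ^ n) G a" for a G X
  proof -
    have "row n X a \<in> set_decode ` row (2 ^ n) G a \<longleftrightarrow>
        (\<exists>y<2 ^ n. a * 2 ^ n + y \<in> set_decode G \<and> set_decode y = row n X a)"
      by (auto simp: row_def[of "2 ^ n"])
    thus ?thesis using row_eq_iff by metis
  qed
  have empty_iff: "(\<forall>x<n. a * n + x \<notin> set_decode X) \<longleftrightarrow> row n X a = {}" for a X
    by (auto simp: row_def)
  have nz_iff: "Y \<noteq> 0 \<longleftrightarrow> set_decode Y \<noteq> {}" for Y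
    by (metis inj_set_decode inj_eq set_decode_zero)
  have coded: "coded_closed n pl m ac c \<longleftrightarrow>
    (\<forall>A<2 ^ m. \<forall>G<2 ^ (m * 2 ^ n).
       (\<forall>a<m. a \<in> set_decode A \<longrightarrow> set_decode ` row (2 ^ n) G a \<in> decode_types c) \<longrightarrow>
       (\<exists>t<2 ^ 2 ^ n. decode_type t \<in> decode_types c \<and>
         (\<forall>X<2 ^ (m * n).
           (\<forall>a<m. (a \<in> set_decode A \<longrightarrow> row n X a \<in> set_decode ` row (2 ^ n) G a) \<and>
              (a \<notin> set_decode A \<longrightarrow> row n X a = {})) \<longrightarrow>
           (\<forall>Y<2 ^ n. set_decode Y \<noteq> {} \<longrightarrow>
              assembles {..<n} pl {..<m} ac (row n X) (set_decode Y) \<longrightarrow>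
              set_decode Y \<in> decode_type t))))" (is "_ \<longleftrightarrow> ?coded")
    unfolding coded_closed_def G_iff X_iff empty_iff nz_iff set_decode_in_decode_type
      decode_type_in_decode_types
    by (simp add: coded_assembles_iff cong: conj_cong imp_cong)
  show ?thesis
    unfolding coded
  proof
    assume *: ?coded
    show "closed_types {..<n} pl {..<m} ac (decode_types c)"
      unfolding closed_types_def
    proof (intro allI impI)
      fix A G assume A: "A \<subseteq> {..<m}" and G: "\<forall>a\<in>A. G a \<in> decode_types c"
      obtain A' where A': "A' < 2 ^ m" "set_decode A' = A" using A by (rule ex_code_of_set)
      \<comment> \<open>Outside \<open>A\<close> the value of \<open>G\<close> is arbitrary, so only
        its members with codes below \<open>2 ^ n\<close> are kept; on \<open>A\<close> this loses
        nothing, as \<open>G a\<close> belongs to \<open>decode_types c\<close>.\<close>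
      obtain G' where G': "G' < 2 ^ (m * 2 ^ n)"
        "\<And>a. a < m \<Longrightarrow> row (2 ^ n) G' a = {y. y < 2 ^ n \<and> set_decode y \<in> G a}"
        by (rule ex_code_of_family[of m "\<lambda>a. {y. y < 2 ^ n \<and> set_decode y \<in> G a}" "2 ^ n"]) auto
      have "decode_types c \<subseteq> Pow (Pow {..<n})"
        using c decode_types_image_lessThan[of n] by blast
      hence Gn: "G a \<subseteq> set_decode ` {..<2 ^ n}" if "a \<in> A" for a
        using G that unfolding set_decode_image_lessThan by blast
      have rowG: "set_decode ` row (2 ^ n) G' a = G a" if "a \<in> A" for a
      proof -
        have "row (2 ^ n) G' a = {y. y < 2 ^ n \<and> set_decode y \<in> G a}" using G'(2) A that by auto
        thus ?thesis using Gn[OF that] by auto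
      qed
      have "\<forall>a<m. a \<in> set_decode A' \<longrightarrow> set_decode ` row (2 ^ n) G' a \<in> decode_types c"
        using A' rowG G by auto
      from *[THEN spec, THEN mp, OF A'(1), THEN spec, THEN mp, OF G'(1), THEN mp, OF this]
      obtain t where t: "decode_type t \<in> decode_types c"
        "\<forall>X<2 ^ (m * n).
           (\<forall>a<m. (a \<in> set_decode A' \<longrightarrow> row n X a \<in> set_decode ` row (2 ^ n) G' a) \<and>
              (a \<notin> set_decode A' \<longrightarrow> row n X a = {})) \<longrightarrow>
           (\<forall>Y<2 ^ n. set_decode Y \<noteq> {} \<longrightarrow>
              assembles {..<n} pl {..<m} ac (row n X) (set_decode Y) \<longrightarrow>
              set_decode Y \<in> decode_type t)"
        by (elim exE conjE)
      show "\<exists>T\<in>decode_types c. \<forall>X. (\<forall>a\<in>{..<m}. X a \<subseteq> {..<n}) \<longrightarrow>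
          (\<forall>a\<in>{..<m}. if a \<in> A then X a \<in> G a else X a = {}) \<longrightarrow>
          (\<forall>Y\<subseteq>{..<n}. Y \<noteq> {} \<longrightarrow> assembles {..<n} pl {..<m} ac X Y \<longrightarrow> Y \<in> T)"
      proof (intro bexI[OF _ t(1)] allI impI)
        fix X Y
        assume X: "\<forall>a\<in>{..<m}. X a \<subseteq> {..<n}"
          "\<forall>a\<in>{..<m}. if a \<in> A then X a \<in> G a else X a = {}"
          and Y: "Y \<subseteq> {..<n}" "Y \<noteq> {}" "assembles {..<n} pl {..<m} ac X Y"
        obtain X' where X': "X' < 2 ^ (m * n)" "\<And>a. a < m \<Longrightarrow> row n X' a = X a"
          by (rule ex_code_of_family[of m X n]) (use X in auto)
        obtain Y' where Y': "Y' < 2 ^ n" "set_decode Y' = Y" using Y(1) by (rule ex_code_of_set)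
        have "assembles {..<n} pl {..<m} ac (row n X') Y"
          using Y(3) X'(2) assembles_cong[of "{..<m}" X "row n X'"] by simp
        moreover have "\<forall>a<m. (a \<in> set_decode A' \<longrightarrow> row n X' a \<in> set_decode ` row (2 ^ n) G' a) \<and>
              (a \<notin> set_decode A' \<longrightarrow> row n X' a = {})"
          using X(2) X'(2) A'(2) rowG by auto
        ultimately show "Y \<in> decode_type t" using t(2) X'(1) Y' Y(2) by blast
      qed
    qed
  next
    assume cl: "closed_types {..<n} pl {..<m} ac (decode_types c)"
    show ?coded
    proof (intro allI impI)
      fix A G assume A: "A < 2 ^ m"
        and G: "\<forall>a<m. a \<in> set_decode A \<longrightarrow> set_decode ` row (2 ^ n) G a \<in> decode_types c"
      have A': "set_decode A \<subseteq> {..<m}" using A by (simp add: less_power2_iff_set_decode)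
      let ?G = "\<lambda>a. set_decode ` row (2 ^ n) G a"
      have "\<forall>a\<in>set_decode A. ?G a \<in> decode_types c" using A' G by auto
      from cl[unfolded closed_types_def, THEN spec, THEN mp, OF A', THEN spec, THEN mp, OF this]
      obtain T where T: "T \<in> decode_types c"
        "\<forall>X. (\<forall>a\<in>{..<m}. X a \<subseteq> {..<n}) \<longrightarrow>
          (\<forall>a\<in>{..<m}. if a \<in> set_decode A then X a \<in> ?G a else X a = {}) \<longrightarrow>
          (\<forall>Y\<subseteq>{..<n}. Y \<noteq> {} \<longrightarrow> assembles {..<n} pl {..<m} ac X Y \<longrightarrow> Y \<in> T)" ..
      then obtain t where t: "t \<in> set_decode c" "T = decode_type t"
        by (auto simp: decode_types_def)
      show "\<exists>t<2 ^ 2 ^ n. decode_type t \<in> decode_types c \<and>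
         (\<forall>X<2 ^ (m * n).
           (\<forall>a<m. (a \<in> set_decode A \<longrightarrow> row n X a \<in> ?G a) \<and>
              (a \<notin> set_decode A \<longrightarrow> row n X a = {})) \<longrightarrow>
           (\<forall>Y<2 ^ n. set_decode Y \<noteq> {} \<longrightarrow>
              assembles {..<n} pl {..<m} ac (row n X) (set_decode Y) \<longrightarrow>
              set_decode Y \<in> decode_type t))"
      proof (intro exI[of _ t] conjI allI impI)
        fix X Y
        assume "\<forall>a<m. (a \<in> set_decode A \<longrightarrow> row n X a \<in> ?G a) \<and>
              (a \<notin> set_decode A \<longrightarrow> row n X a = {})"
          "Y < 2 ^ n" "set_decode Y \<noteq> {}"
          "assembles {..<n} pl {..<m} ac (row n X) (set_decode Y)"
        thus "set_decode Y \<in> decode_type t"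
          using T(2)[rule_format, of "row n X" "set_decode Y"] t(2) row_subset
          by (simp add: less_power2_iff_set_decode)
      qed (use t c_less decode_type_in_decode_types in auto)
    qed
  qed
qed

lemma coded_distributive_iff:
  assumes c: "c < 2 ^ 2 ^ 2 ^ n"
  shows "coded_distributive n pl m ac c \<longleftrightarrow>
    distributive_types {..<n} pl {..<m} ac (decode_types c)"
proof -
  have c_less: "t < 2 ^ 2 ^ n" if "t \<in> set_decode c" for t
    using c that unfolding less_power2_iff_set_decode[of c] by blast
  have "set_decode (2 ^ g) = {g}" for g
    using set_encode_inverse[of "{g}"] by (simp add: set_encode_def)
  hence sing: "2 ^ g \<in> set_decode t \<longleftrightarrow> {g} \<in> decode_type t" for g t
    using set_decode_in_decode_type[of "2 ^ g" t] by simp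
  show ?thesis
    unfolding coded_distributive_def distributive_types_def sing decode_types_def
    using c_less by (auto simp del: all_simps) blast
qed

definition coded_criterion ::
  "nat \<Rightarrow> (nat \<Rightarrow> nat \<Rightarrow> nat) \<Rightarrow> nat \<Rightarrow> (nat \<Rightarrow> nat \<Rightarrow> nat) \<Rightarrow> bool"
where
  "coded_criterion n pl m ac \<longleftrightarrow>
     (\<exists>c<2 ^ 2 ^ 2 ^ n. coded_closed n pl m ac c \<and> coded_distributive n pl m ac c)"

lemma two_distributive_iff_coded_criterion:
  assumes "forest_algebra {..<n} pl z {..<m} mu e ac"
  shows "two_distributive {..<n} pl z {..<m} mu e ac \<longleftrightarrow> coded_criterion n pl m ac"
proof -
  interpret finite_forest_algebra "{..<n}" pl z "{..<m}" mu e ac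
    by unfold_locales (use assms in auto)
  have "(\<exists>C\<subseteq>Pow (Pow {..<n}). P C) \<longleftrightarrow> (\<exists>c<2 ^ 2 ^ 2 ^ n. P (decode_types c))" for P
  proof -
    have "(\<exists>C\<in>Pow (Pow (Pow {..<n})). P C) \<longleftrightarrow> (\<exists>c\<in>{..<2 ^ 2 ^ 2 ^ n}. P (decode_types c))"
      by (simp flip: decode_types_image_lessThan del: Pow_iff)
    thus ?thesis by auto
  qed
  thus ?thesis
    unfolding two_distributive_iff_types coded_criterion_def
    by (auto simp: coded_closed_iff coded_distributive_iff)
qed

section \<open>Decidability of the criterion and transfer to tables\<close>

lemma All_less_cong:
  "n = n' \<Longrightarrow> (\<And>i. i < n' \<Longrightarrow> P i = Q i) \<Longrightarrow> (\<forall>i<n::nat. P i) \<longleftrightarrow> (\<forall>i<n'. Q i)"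
  by simp

lemma Ex_less_cong:
  "n = n' \<Longrightarrow> (\<And>i. i < n' \<Longrightarrow> P i = Q i) \<Longrightarrow> (\<exists>i<n::nat. P i) \<longleftrightarrow> (\<exists>i<n'. Q i)"
  by auto

text \<open>Table entries and decoded entries are only known to agree in range. The congruence rules
  supply the bound of each variable, and closure below \<open>n\<close> keeps nested applications in
  range.\<close>

lemma coded_criterion_cong:
  assumes pl: "\<And>a b. a < n \<Longrightarrow> b < n \<Longrightarrow> pl a b = pl' a b \<and> pl a b < n"
    and ac: "\<And>a b. a < m \<Longrightarrow> b < n \<Longrightarrow> ac a b = ac' a b \<and> ac a b < n"
  shows "coded_criterion n pl m ac \<longleftrightarrow> coded_criterion n pl' m ac'"
proof -
  have pl': "pl a b = pl' a b" "pl' a b < n" if "a < n" "b < n" for a b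
    using pl[OF that] by simp_all
  have ac': "ac a b = ac' a b" "ac' a b < n" if "a < m" "b < n" for a b
    using ac[OF that] by simp_all
  have "coded_assembles n pl m ac = coded_assembles n pl' m ac'"
    unfolding coded_assembles_def fun_eq_iff
    by (simp add: pl' ac' cong: All_less_cong Ex_less_cong cong del: imp_cong)
  hence "coded_closed n pl m ac = coded_closed n pl' m ac'"
    unfolding coded_closed_def fun_eq_iff by simp
  moreover have "coded_distributive n pl m ac = coded_distributive n pl' m ac'"
    unfolding coded_distributive_def fun_eq_iff
    by (simp add: pl' ac' cong: All_less_cong Ex_less_cong cong del: imp_cong)
  ultimately show ?thesis by (simp add: coded_criterion_def)
qed

lemma decidable_coded_criterion:
  assumes "computable k n" "computable k p" "computable k m" "computable k q"
  shows "decidable k (\<lambda>xs. coded_criterion (n xs) (\<lambda>a b. code_nth (p xs) (a * n xs + b))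
    (m xs) (\<lambda>a b. code_nth (q xs) (a * n xs + b)))"
proof (rule decidable_comp4[of "\<lambda>n p m q. coded_criterion n (\<lambda>a b. code_nth p (a * n + b))
    m (\<lambda>a b. code_nth q (a * n + b))", OF _ assms])
  show "decidable 4 (\<lambda>xs. coded_criterion (hd xs) (\<lambda>a b. code_nth (hd (tl xs)) (a * hd xs + b))
    (hd (tl (tl xs))) (\<lambda>a b. code_nth (hd (tl (tl (tl xs)))) (a * hd xs + b)))"
    \<comment> \<open>Once unfolded, every quantifier is bounded by a computable term and every atom
      is an equation or a bit test.\<close>
    unfolding coded_criterion_def coded_closed_def coded_distributive_def coded_assembles_def
    by (rule computability_rules decidable_mem_set_decode computable_code_nth | simp)+
qed

theorem mainTheorem2:
  shows "\<exists>p::recf. \<forall>n m P M A. table_fa n m P M A \<longrightarrow>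
           recf_eval p [table_code n m P M A] (if table_2dist n m P M A then 1 else 0)"
proof -
  \<comment> \<open>Entries 0, 1, 2 and 4 of the coded input are \<open>n\<close>, \<open>m\<close>,
    the addition table and the action table.\<close>
  let ?n = "\<lambda>xs. code_nth (hd xs) 0" and ?m = "\<lambda>xs. code_nth (hd xs) 1"
  let ?p = "\<lambda>xs. code_nth (hd xs) 2" and ?q = "\<lambda>xs. code_nth (hd xs) 4"
  have "decidable 1 (\<lambda>xs. coded_criterion (?n xs) (\<lambda>a b. code_nth (?p xs) (a * ?n xs + b))
    (?m xs) (\<lambda>a b. code_nth (?q xs) (a * ?n xs + b)))"
    by (rule decidable_coded_criterion computable_code_nth computability_rules | simp)+
  then obtain r where r: "\<And>c. recf_eval r [c]
      (of_bool (coded_criterion (?n [c]) (\<lambda>a b. code_nth (?p [c]) (a * ?n [c] + b))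
        (?m [c]) (\<lambda>a b. code_nth (?q [c]) (a * ?n [c] + b))))"
    unfolding decidable_def computable_def by (metis One_nat_def length_Cons list.size(3))
  show ?thesis
  proof (intro exI[of _ r] allI impI)
    fix n m P M A assume t: "table_fa n m P M A"
    then obtain z e where fa: "forest_algebra {..<n} (tbl n P) z {..<m} (tbl m M) e (tbl n A)"
      and len: "length P = n * n" "length A = m * n"
      by (auto simp: table_fa_def)
    let ?c = "table_code n m P M A"
    let ?pl = "\<lambda>a b. code_nth (list_encode P) (a * n + b)"
    let ?ac = "\<lambda>a b. code_nth (list_encode A) (a * n + b)"
    have c: "?n [?c] = n" "?m [?c] = m" "?p [?c] = list_encode P" "?q [?c] = list_encode A"
      unfolding table_code_def by (simp_all add: code_nth_list_encode del: list_encode.simps)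
    have idx: "a * n + b < k * n" if "a < k" "b < n" for a b k
    proof -
      have "a * n + b < Suc a * n" using that by simp
      also have "\<dots> \<le> k * n" using that by (intro mult_le_mono1) simp
      finally show ?thesis .
    qed
    have "coded_criterion n (tbl n P) m (tbl n A) \<longleftrightarrow> coded_criterion n ?pl m ?ac"
    proof (rule coded_criterion_cong)
      show "tbl n P a b = ?pl a b \<and> tbl n P a b < n" if "a < n" "b < n" for a b
        using fa that len idx[of a n b]
        by (auto simp: forest_algebra_def tbl_def code_nth_list_encode)
      show "tbl n A a b = ?ac a b \<and> tbl n A a b < n" if "a < m" "b < n" for a b
        using fa that len idx[of a m b]
        by (auto simp: forest_algebra_def tbl_def code_nth_list_encode)
    qed
    \<comment> \<open>The criterion is expressed through the tables alone, so the equivalence holds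
      for whichever \<open>z\<close> and \<open>e\<close> witness
      \<open>table_2dist\<close>.\<close>
    moreover have "table_2dist n m P M A \<longleftrightarrow> coded_criterion n (tbl n P) m (tbl n A)"
      using fa two_distributive_iff_coded_criterion unfolding table_2dist_def by metis
    ultimately show "recf_eval r [?c] (if table_2dist n m P M A then 1 else 0)"
      using r[of ?c] unfolding c by (simp add: of_bool_def)
  qed
qed

end
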